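(* For any ordinals $\alpha, \beta < \omega_1$, any $\boldsymbol{\Sigma}^0_{\alpha+1}$-measurable function $f \colon 2^{\mathbb{N}} \rightarrow 2^{\mathbb{N}}$, and any $(\alpha+\beta)$-tree function $g \colon 2^{\mathbb{N}} \rightarrow \{0,1\}$, there exists a restriction $\rho$ such that $f^\rho$ is continuous and $g^\rho$ is a $\beta$-tree function.
   Context: Borel classes. $2^{\mathbb{N}}$ has the product topology. A set $S\subseteq 2^{\mathbb{N}}$ is $\boldsymbol{\Sigma}^0_0$ (equivalently $\boldsymbol{\Pi}^0_0$) if it is clopen. For $1\le\alpha<\omega_1$, a set is $\boldsymbol{\Sigma}^0_\alpha$ (resp. $\boldsymbol{\Pi}^0_\alpha$) if it is a countable union (resp. intersection) of sets $S_n$, $n\in\mathbb{N}$, each of which is $\boldsymbol{\Pi}^0_{\beta_n}$ (resp. $\boldsymbol{\Sigma}^0_{\beta_n}$) for some $\beta_n<\alpha$ (for $\alpha\geq 1$ this is the usual Borel hierarchy). A function $f\colon 2^{\mathbb{N}}\to Y$ with $Y=2^{\mathbb{N}}$ or $Y=\{0,1\}$ (discrete) is $\boldsymbol{\Sigma}^0_\alpha$-measurable if $f^{-1}(U)\in\boldsymbol{\Sigma}^0_\alpha$ for every open $U\subseteq Y$. Tree functions. The full trees $T_\alpha$ ($\alpha<\omega_1$) are rooted trees defined recursively: $T_0$ is a single vertex (the root); $T_{\alpha+1}$ consists of a root whose children are the roots of $\omega$-many disjoint copies of $T_\alpha$; for limit $\alpha$, $T_\alpha$ consists of a root whose children are the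 roots of $\omega$-many disjoint copies of $T_\beta$ for each $\beta<\alpha$. A full alternating tree of rank $\alpha$ is obtained from $T_\alpha$ by labeling the leaves injectively with variables $x_i$ (positive literals), and labeling each non-leaf vertex with $\wedge$ or $\vee$ so that no $\wedge$-vertex has an $\wedge$-vertex as a child and no $\vee$-vertex has a $\vee$-vertex as a child. On an input $x$, a leaf labeled $x_i$ evaluates to the $i$-th bit of $x$, an $\wedge$-vertex (resp. $\vee$-vertex) evaluates to the conjunction (resp. disjunction) of the values of its children, and the output is the value of the root. A function to $\{0,1\}$ is an $\alpha$-tree function if it is computed by a full alternating tree of rank $\alpha$ (not all variables need appear as labels). The same definition is used for functions on $2^I$ with $I\subseteq\mathbb{N}$, with the variables being $x_i$, $i\in I$. Restrictions. A restriction is a function $\rho\colon\mathbb{N}\to\{0,1,*\}$. For a function $f$ on $2^{\mathbb{N}}$, the restricted function $f^\rho$ has domain $2^{\rho^{-1}(\{*\})}$ (product topology): given values for the variables $x_i$ with $\rho(i)=*$, it evaluates $f$ on the input obtained by setting every other $x_i$ to $\rho(i)$. *)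

theory Defs
  imports "HOL-Analysis.Analysis" "HOL-Library.Countable_Set_Type"
begin

section \<open>Countable ordinals\<close>

text \<open>
  The ordinals below \<open>\<omega>\<^sub>1\<close> are the elements of the initial well-order of the least uncountable
  cardinal, the cardinal successor of \<^term>\<open>natLeq\<close>.
\<close>

typedef omega1 = "Field (cardSuc natLeq)"
  morphisms rep_omega1 abs_omega1
proof -
  have "infinite (Field (cardSuc natLeq))"
    using cardSuc_finite[OF natLeq_Card_order] by (simp add: Field_natLeq)
  then show ?thesis
    by (metis ex_in_conv finite.emptyI)
qed

lemma Well_order_omega1: "Well_order (cardSuc natLeq)"
  using cardSuc_Card_order[OF natLeq_Card_order] by (simp add: card_order_on_def)

instantiation omega1 :: linorder
begin

definition less_eq_omega1 :: "omega1 \<Rightarrow> omega1 \<Rightarrow> bool"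
  where "a \<le> b \<longleftrightarrow> (rep_omega1 a, rep_omega1 b) \<in> cardSuc natLeq"

definition less_omega1 :: "omega1 \<Rightarrow> omega1 \<Rightarrow> bool"
  where "a < b \<longleftrightarrow> a \<le> b \<and> \<not> b \<le> (a::omega1)"

instance
proof
  note wo = Well_order_omega1[unfolded well_order_on_def linear_order_on_def
      partial_order_on_def preorder_on_def]
  fix x y z :: omega1
  show "x < y \<longleftrightarrow> x \<le> y \<and> \<not> y \<le> x"
    by (rule less_omega1_def)
  show "x \<le> x"
    using wo rep_omega1[of x] by (auto simp: less_eq_omega1_def refl_on_def)
  show "x \<le> z" if "x \<le> y" "y \<le> z"
    using wo that unfolding less_eq_omega1_def by (meson transD)
  show "x = y" if "x \<le> y" "y \<le> x"
    using wo that unfolding less_eq_omega1_def by (meson antisymD rep_omega1_inject)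
  show "x \<le> y \<or> y \<le> x"
    using wo rep_omega1[of x] rep_omega1[of y] \<open>x \<le> x\<close>
    unfolding less_eq_omega1_def total_on_def by metis
qed

end

lemma less_omega1_iff:
  "a < b \<longleftrightarrow> (rep_omega1 a, rep_omega1 b) \<in> cardSuc natLeq - Id" for a b :: omega1
  using rep_omega1_inject[of a b] by (auto simp: less_le less_eq_omega1_def)

instance omega1 :: wellorder
proof
  fix P :: "omega1 \<Rightarrow> bool" and a
  assume step: "\<And>x. (\<And>y. y < x \<Longrightarrow> P y) \<Longrightarrow> P x"
  have "wf {(x, y :: omega1). x < y}"
  proof (rule wf_subset)
    show "wf (inv_image (cardSuc natLeq - Id) rep_omega1)"
      using Well_order_omega1 by (auto simp: well_order_on_def intro: wf_inv_image)
  qed (auto simp: less_omega1_iff inv_image_def)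
  then show "P a"
    by (rule wf_induct_rule) (use step in auto)
qed

lemma countable_lessThan_omega1: "countable {..<a :: omega1}"
proof -
  let ?r = "cardSuc natLeq :: nat set rel"
  have "(card_of (underS ?r (rep_omega1 a)), ?r) \<in> ordLess"
    using card_of_underS[OF cardSuc_Card_order[OF natLeq_Card_order]] rep_omega1 by blast
  then have "(card_of (underS ?r (rep_omega1 a)), natLeq) \<in> ordLeq"
    using cardSuc_ordLeq_ordLess[OF natLeq_Card_order card_of_Card_order] by blast
  then have "countable (underS ?r (rep_omega1 a))"
    by (simp add: countable_card_le_natLeq)
  moreover have "rep_omega1 ` {..<a} \<subseteq> underS ?r (rep_omega1 a)"
    by (auto simp: less_omega1_iff underS_def)
  ultimately have "countable (rep_omega1 ` {..<a})"
    by (rule countable_subset[rotated])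
  then show ?thesis
    by (rule countable_image_inj_on) (simp add: inj_on_def rep_omega1_inject)
qed

lemma uncountable_omega1: "uncountable (UNIV :: omega1 set)"
proof
  let ?r = "cardSuc natLeq :: nat set rel"
  assume "countable (UNIV :: omega1 set)"
  then have "countable (range rep_omega1)"
    by simp
  then have "countable (Field ?r)"
    using type_definition.Rep_range[OF type_definition_omega1] by simp
  then have "(card_of (Field ?r), natLeq) \<in> ordLeq"
    by (simp add: countable_card_le_natLeq)
  then have "(?r, natLeq) \<in> ordLeq"
    using card_of_Field_ordIso[OF cardSuc_Card_order[OF natLeq_Card_order]]
      ordIso_symmetric ordIso_ordLeq_trans by blast
  moreover have "(natLeq, ?r) \<in> ordLess"
    by (rule cardSuc_greater[OF natLeq_Card_order])
  ultimately show False
    using not_ordLess_ordLeq by blast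
qed

lemma countable_bounded_omega1:
  fixes A :: "omega1 set"
  assumes "countable A"
  shows "\<exists>c. \<forall>a\<in>A. a < c"
proof -
  have "countable {..a}" for a :: omega1
    using countable_lessThan_omega1[of a] by (simp flip: ivl_disj_un_singleton(2))
  then have "countable (\<Union>a\<in>A. {..a})"
    using assms by blast
  then have "(\<Union>a\<in>A. {..a}) \<noteq> UNIV"
    using uncountable_omega1 by metis
  then obtain c where "\<forall>a\<in>A. \<not> c \<le> a"
    by auto
  then show ?thesis
    by (auto simp: not_le)
qed

definition osuc :: "omega1 \<Rightarrow> omega1"
  where "osuc a = (LEAST b. a < b)"

lemma less_osuc: "a < osuc a"
  unfolding osuc_def using countable_bounded_omega1[of "{a}"] by (auto intro: LeastI_ex)

lemma osuc_le_iff: "osuc a \<le> b \<longleftrightarrow> a < b"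
  using less_osuc[of a] unfolding osuc_def by (auto intro: Least_le order.strict_trans2)

instantiation omega1 :: "{zero, plus}"
begin

definition zero_omega1 :: omega1
  where "zero_omega1 = (LEAST a. True)"

text \<open>
  \<open>a + b = sup ({a} \<union> {(a + b') + 1 | b' < b})\<close>; the familiar recursion equations are
  \<open>oadd_zero\<close>, \<open>oadd_osuc\<close> and \<open>oadd_limit\<close> below.
\<close>

function plus_omega1 :: "omega1 \<Rightarrow> omega1 \<Rightarrow> omega1"
  where "plus_omega1 a b = (LEAST c. a \<le> c \<and> (\<forall>d \<in> plus_omega1 a ` {..<b}. d < c))"
  by auto
termination
  by (relation "inv_image {(x, y). x < y} snd") (auto intro: wf)

instance ..

end

declare plus_omega1.simps [simp del]

lemma zero_le_omega1: "0 \<le> (a :: omega1)"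
  by (simp add: zero_omega1_def Least_le)

definition olimit :: "omega1 \<Rightarrow> bool"
  where "olimit a \<longleftrightarrow> a \<noteq> 0 \<and> (\<nexists>b. a = osuc b)"

lemma olimit_osuc_less:
  assumes "olimit a" "b < a"
  shows "osuc b < a"
  using assms osuc_le_iff[of b a] by (auto simp: olimit_def le_less)

lemma oadd_bounds: "a \<le> a + b" "c < b \<Longrightarrow> a + c < a + b" for a b c :: omega1
proof -
  have "countable (insert a ((+) a ` {..<b}))"
    using countable_lessThan_omega1 by blast
  then obtain u where "\<forall>d \<in> insert a ((+) a ` {..<b}). d < u"
    using countable_bounded_omega1 by blast
  then have "\<exists>c. a \<le> c \<and> (\<forall>d \<in> (+) a ` {..<b}. d < c)"
    by (auto intro!: exI[of _ u])
  from LeastI_ex[OF this] have "a \<le> a + b \<and> (\<forall>d \<in> (+) a ` {..<b}. d < a + b)"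
    unfolding plus_omega1.simps[of a b, symmetric] .
  then show "a \<le> a + b" "c < b \<Longrightarrow> a + c < a + b"
    by auto
qed

lemma oadd_least: "a + b \<le> u" if "a \<le> u" "\<And>c. c < b \<Longrightarrow> a + c < u" for a b u :: omega1
  unfolding plus_omega1.simps[of a b] by (rule Least_le) (use that in auto)

lemma oadd_zero: "a + 0 = (a :: omega1)"
  using zero_le_omega1 by (intro antisym oadd_least oadd_bounds) (auto simp: not_less[symmetric])

lemma oadd_osuc: "a + osuc b = osuc (a + b)"
proof (rule antisym)
  have *: "c \<le> b" if "c < osuc b" for c
    using that osuc_le_iff[of b c] by (meson not_less)
  show "a + osuc b \<le> osuc (a + b)"
  proof (rule oadd_least)
    show "a \<le> osuc (a + b)"
      using oadd_bounds(1)[of a b] less_osuc[of "a + b"] by (meson order.strict_trans1 less_imp_le)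
    show "a + c < osuc (a + b)" if "c < osuc b" for c
      using *[OF that] oadd_bounds(2)[of c b a] less_osuc[of "a + b"]
      by (metis le_less less_trans)
  qed
  show "osuc (a + b) \<le> a + osuc b"
    by (simp add: osuc_le_iff oadd_bounds(2) less_osuc)
qed

lemma oadd_limit:
  assumes "olimit b"
  shows "a + b \<le> u \<longleftrightarrow> (\<forall>c<b. a + c \<le> u)"
proof (intro iffI allI impI)
  show "a + c \<le> u" if "a + b \<le> u" "c < b" for c
    using that oadd_bounds(2)[of c b a] by simp
next
  assume u: "\<forall>c<b. a + c \<le> u"
  show "a + b \<le> u"
  proof (rule oadd_least)
    have "0 < b"
      using assms zero_le_omega1[of b] by (simp add: olimit_def le_less)
    then show "a \<le> u"
      using u oadd_zero[of a] by metis
    show "a + c < u" if "c < b" for c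
      using u olimit_osuc_less[OF assms that] oadd_bounds(2)[OF less_osuc, of a c]
      by (meson order.strict_trans2)
  qed
qed

section \<open>Borel classes\<close>

text \<open>
  The space \<open>2\<^sup>I\<close> for \<open>I \<subseteq> \<nat>\<close>; its points are the functions on \<open>I\<close>, represented as usual by
  extensional functions. The space \<open>cantor UNIV\<close> has all functions as points.
\<close>

definition cantor :: "nat set \<Rightarrow> (nat \<Rightarrow> bool) topology"
  where "cantor I = product_topology (\<lambda>i. discrete_topology UNIV) I"

lemma topspace_cantor: "topspace (cantor I) = (\<Pi>\<^sub>E i\<in>I. UNIV)"
  by (simp add: cantor_def)

lemma topspace_cantor_UNIV: "topspace (cantor UNIV) = UNIV"
  by (simp add: topspace_cantor)

inductive Sigma0 :: "'a topology \<Rightarrow> omega1 \<Rightarrow> 'a set \<Rightarrow> bool"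
  and Pi0 :: "'a topology \<Rightarrow> omega1 \<Rightarrow> 'a set \<Rightarrow> bool"
  for X :: "'a topology"
  where
    Sigma0_clopen: "openin X S \<Longrightarrow> closedin X S \<Longrightarrow> Sigma0 X 0 S"
  | Pi0_clopen: "openin X S \<Longrightarrow> closedin X S \<Longrightarrow> Pi0 X 0 S"
  | Sigma0_Union: "0 < \<alpha> \<Longrightarrow> (\<And>n::nat. \<beta> n < \<alpha>) \<Longrightarrow> (\<And>n. Pi0 X (\<beta> n) (S n))
      \<Longrightarrow> Sigma0 X \<alpha> (\<Union>n. S n)"
  | Pi0_Inter: "0 < \<alpha> \<Longrightarrow> (\<And>n::nat. \<beta> n < \<alpha>) \<Longrightarrow> (\<And>n. Sigma0 X (\<beta> n) (S n))
      \<Longrightarrow> Pi0 X \<alpha> (\<Inter>n. S n)"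

definition Sigma0_measurable ::
    "omega1 \<Rightarrow> 'a topology \<Rightarrow> 'b topology \<Rightarrow> ('a \<Rightarrow> 'b) \<Rightarrow> bool"
  where "Sigma0_measurable \<alpha> X Y f \<longleftrightarrow>
    f \<in> topspace X \<rightarrow> topspace Y \<and>
    (\<forall>U. openin Y U \<longrightarrow> Sigma0 X \<alpha> {x \<in> topspace X. f x \<in> U})"

section \<open>Tree functions\<close>

datatype gate = Conj | Disj

text \<open>
  Trees with leaves labeled by (indices of) variables and inner vertices labeled by gates. Every
  inner vertex of a full tree has exactly \<open>\<omega>\<close> many children, so they are enumerated by \<open>\<nat>\<close>.
\<close>

datatype tree = Leaf nat | Node gate "nat \<Rightarrow> tree"

text \<open>
  \<open>full_tree \<alpha> t\<close>: the underlying unlabeled tree of \<open>t\<close> is (isomorphic to) \<open>T\<^sub>\<alpha>\<close>. For limit \<open>\<alpha>\<close>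
  the children of the root correspond to the pairs \<open>(\<beta>, k)\<close> with \<open>\<beta> < \<alpha>\<close> and \<open>k \<in> \<nat>\<close>, the child
  for \<open>(\<beta>, k)\<close> being the \<open>k\<close>-th copy of \<open>T\<^sub>\<beta>\<close>; \<open>e\<close> enumerates these pairs, in any order.
\<close>

inductive full_tree :: "omega1 \<Rightarrow> tree \<Rightarrow> bool"
  where
    full_tree_zero: "full_tree 0 (Leaf i)"
  | full_tree_osuc: "(\<And>n. full_tree \<alpha> (ts n)) \<Longrightarrow> full_tree (osuc \<alpha>) (Node c ts)"
  | full_tree_limit: "olimit \<alpha> \<Longrightarrow> bij_betw e (UNIV :: nat set) ({..<\<alpha>} \<times> (UNIV :: nat set))
      \<Longrightarrow> (\<And>n. full_tree (fst (e n)) (ts n)) \<Longrightarrow> full_tree \<alpha> (Node c ts)"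

primrec vars :: "tree \<Rightarrow> nat set"
  where
    "vars (Leaf i) = {i}"
  | "vars (Node c ts) = (\<Union>n. vars (ts n))"

text \<open>No variable labels two different leaves.\<close>

primrec inj_leaves :: "tree \<Rightarrow> bool"
  where
    "inj_leaves (Leaf i) \<longleftrightarrow> True"
  | "inj_leaves (Node c ts) \<longleftrightarrow>
      (\<forall>n. inj_leaves (ts n)) \<and> (\<forall>m n. m \<noteq> n \<longrightarrow> vars (ts m) \<inter> vars (ts n) = {})"

fun root_gate :: "tree \<Rightarrow> gate option"
  where
    "root_gate (Leaf i) = None"
  | "root_gate (Node c ts) = Some c"

primrec alternating :: "tree \<Rightarrow> bool"
  where
    "alternating (Leaf i) \<longleftrightarrow> True"
  | "alternating (Node c ts) \<longleftrightarrow> (\<forall>n. alternating (ts n) \<and> root_gate (ts n) \<noteq> Some c)"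

primrec tree_val :: "tree \<Rightarrow> (nat \<Rightarrow> bool) \<Rightarrow> bool"
  where
    "tree_val (Leaf i) x = x i"
  | "tree_val (Node c ts) x =
      (case c of Conj \<Rightarrow> \<forall>n. tree_val (ts n) x | Disj \<Rightarrow> \<exists>n. tree_val (ts n) x)"

definition full_alternating_tree :: "omega1 \<Rightarrow> tree \<Rightarrow> bool"
  where "full_alternating_tree \<alpha> t \<longleftrightarrow> full_tree \<alpha> t \<and> inj_leaves t \<and> alternating t"

text \<open>\<open>tree_function I \<alpha> h\<close>: the function \<open>h\<close> on \<open>2\<^sup>I\<close> is an \<open>\<alpha>\<close>-tree function.\<close>

definition tree_function :: "nat set \<Rightarrow> omega1 \<Rightarrow> ((nat \<Rightarrow> bool) \<Rightarrow> bool) \<Rightarrow> bool"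
  where "tree_function I \<alpha> h \<longleftrightarrow>
    (\<exists>t. full_alternating_tree \<alpha> t \<and> vars t \<subseteq> I \<and> (\<forall>x \<in> topspace (cantor I). h x = tree_val t x))"

section \<open>Restrictions\<close>

text \<open>A restriction maps each index to \<open>0\<close>, \<open>1\<close> or \<open>*\<close>, the latter being represented by \<^term>\<open>None\<close>.\<close>

type_synonym restriction = "nat \<Rightarrow> bool option"

definition stars :: "restriction \<Rightarrow> nat set"
  where "stars \<rho> = {i. \<rho> i = None}"

text \<open>\<open>restr \<rho> f\<close> is \<open>f\<^sup>\<rho>\<close>, a function on \<open>2\<^sup>I\<close> for \<open>I = stars \<rho>\<close>.\<close>

definition restr :: "restriction \<Rightarrow> ((nat \<Rightarrow> bool) \<Rightarrow> 'b) \<Rightarrow> (nat \<Rightarrow> bool) \<Rightarrow> 'b"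
  where "restr \<rho> f y = f (\<lambda>i. case \<rho> i of None \<Rightarrow> y i | Some b \<Rightarrow> b)"

end

theory Submission
  imports Defs
begin

text \<open>
  Restricting a tree function costs its tree the bottom \<open>\<alpha>\<close> levels, and this pays for making
  countably many Borel sets of level \<open>\<alpha>\<close> clopen. If \<open>f\<close> is \<open>\<Sigma>\<^sup>0\<close>-measurable of rank \<open>\<alpha> + 1\<close>, then
  every preimage \<open>{x. f x k = b}\<close> is a countable union of sets of level \<open>\<alpha>\<close>; once these are clopen,
  the preimages are open and \<open>f\<close> has become continuous. So everything reduces to the switching
  statement \<open>switching \<alpha>\<close>: countably many sets of level \<open>\<alpha>\<close> and a family of disjoint trees of
  ranks \<open>\<alpha> + \<beta>\<^sub>s\<close> with \<open>\<beta>\<^sub>s > 0\<close> admit one restriction that makes all sets clopen and leaves trees of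
  ranks \<open>\<beta>\<^sub>s\<close>. (For \<open>\<beta> = 0\<close> the theorem is easy: the tree is collapsed to one variable, and on
  a two-point space every function is continuous.)

  The switching statement is proved by induction on \<open>\<alpha>\<close>. If \<open>\<alpha> = \<delta> + \<eta>\<close> with \<open>\<delta>, \<eta> < \<alpha>\<close>, then the
  levels are peeled off in two rounds (\<open>switching_oadd\<close>). Otherwise \<open>\<alpha>\<close> is \<open>0\<close>, which is trivial, or
  additively indecomposable: \<open>\<delta> + \<alpha> = \<alpha>\<close> for all \<open>\<delta> < \<alpha>\<close>. In the latter case the subtrees of rank
  exactly \<open>\<alpha>\<close>, the blocks, are cut out of the trees (\<open>ex_contraction\<close>). It then suffices to turn some
  blocks into single variables, infinitely many below each parent, and the other blocks into
  constants that do not affect their parents. The lemma \<open>fusion\<close> does this in countably many stages.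

  At a finite stage a restriction \<open>\<rho>\<close> and a finite set \<open>V\<close> of variables, the stars, have been chosen;
  all but finitely many blocks still have rank \<open>\<alpha>\<close> under \<open>\<rho>\<close>. Indecomposability is what keeps the
  process alive: by induction a set \<open>C\<close> of level \<open>\<delta> < \<alpha>\<close> can be made clopen at the cost of \<open>\<delta>\<close> levels
  of each block, and the block left over has rank \<open>\<alpha>\<close> again. A clopen set depends on
  finitely many variables, and fixing those which are not stars spoils only finitely many blocks;
  these are sacrificed (\<open>settle\<close>), and \<open>C\<close> depends on \<open>V\<close> only (\<open>determine\<close>).

  A set of level \<open>\<alpha>\<close> is, up to complement, an intersection of sets \<open>C k\<close> of lower levels. It is decided
  by forcing (\<open>resolve\<close>): for each of the finitely many assignments to \<open>V\<close>, either some extension of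
  the present state puts the cylinder of the assignment outside some \<open>C k\<close>, and such an
  extension is taken, or no extension can do so, and then every \<open>C k\<close> will contain the cylinder from
  the moment at which it is determined. In either case the set depends on \<open>V\<close> only in the limit.
  The delicate point is that an extension with more stars must be turned into one with the stars \<open>V\<close>
  only. For that purpose a star does not replace its block: the block remains a gate applied to
  the star and to a residual tree of rank \<open>\<alpha>\<close>, so that the controlling value of that gate can still
  be enforced whatever value has been given to the star. The residual is used up only in the
  limit, one child of the block at a time.
\<close>

section \<open>Ordinal arithmetic\<close>

lemma oadd_less_iff: "a + b < a + c \<longleftrightarrow> b < c" for a b c :: omega1
  by (metis linorder_neqE oadd_bounds(2) order_less_asym order_less_irrefl)

lemma oadd_left_cancel: "a + b = a + c \<longleftrightarrow> b = c" for a b c :: omega1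
  by (metis linorder_neqE oadd_less_iff order_less_irrefl)

lemma osuc_inject: "osuc a = osuc b \<longleftrightarrow> a = b"
  by (metis less_osuc linorder_neqE not_le osuc_le_iff)

lemma oadd_zero_left: "0 + b = (b :: omega1)"
proof (induction b rule: less_induct)
  case (less b)
  have "0 + b \<le> b"
    by (rule oadd_least) (use zero_le_omega1 less in auto)
  moreover have "\<not> 0 + b < b"
    using less[of "0 + b"] oadd_less_iff[of 0 "0 + b" b] by auto
  ultimately show ?case
    by simp
qed

lemma le_oadd_right: "b \<le> a + b" for a b :: omega1
proof (induction b rule: less_induct)
  case (less b)
  then show ?case
    using oadd_less_iff[of a "a + b" b] by (meson leD not_less)
qed

lemma oadd_subtract:
  fixes a b :: omega1
  assumes "a \<le> b"
  obtains c where "b = a + c"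
proof -
  define c where "c = (LEAST c. b \<le> a + c)"
  have "b \<le> a + c"
    unfolding c_def using le_oadd_right by (rule LeastI)
  moreover have "a + c \<le> b"
    by (rule oadd_least) (use assms not_less_Least[of _ "\<lambda>c. b \<le> a + c"] in \<open>auto simp: c_def not_le\<close>)
  ultimately show thesis
    using that by auto
qed

lemma oadd_assoc: "(a + b) + c = a + (b + c)" for a b c :: omega1
proof (induction c rule: less_induct)
  case (less c)
  have mono: "a + d \<le> a + e" if "d \<le> e" for d e
    using that oadd_less_iff[of a e d] by (simp add: not_less[symmetric])
  show ?case
  proof (rule antisym)
    show "(a + b) + c \<le> a + (b + c)"
      by (rule oadd_least) (use less mono oadd_bounds oadd_less_iff in auto)
    show "a + (b + c) \<le> (a + b) + c"
    proof (rule oadd_least)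
      show "a \<le> a + b + c"
        using oadd_bounds(1) order.trans by blast
    next
      fix e assume e: "e < b + c"
      show "a + e < a + b + c"
      proof (cases "e < b")
        case True
        then show ?thesis
          using oadd_bounds order.strict_trans2 by blast
      next
        case False
        then have "b \<le> e"
          by simp
        then obtain d where "e = b + d"
          by (rule oadd_subtract)
        then show ?thesis
          using e less oadd_less_iff by metis
      qed
    qed
  qed
qed

section \<open>Full trees\<close>

text \<open>
  A tree is full of rank \<open>\<alpha> > 0\<close> iff its children are full trees of ranks in \<open>child_ranks \<alpha>\<close> and each of
  these ranks occurs infinitely often. This description treats successors and limits alike, and, unlike
  an enumeration of the children, it obviously survives the removal of finitely many of them.
\<close>

definition child_ranks :: "omega1 \<Rightarrow> omega1 set"
  where "child_ranks \<alpha> = {\<gamma>. \<gamma> < \<alpha> \<and> (olimit \<alpha> \<or> osuc \<gamma> = \<alpha>)}"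

lemma child_ranks_nonempty:
  assumes "0 < \<alpha>"
  shows "child_ranks \<alpha> \<noteq> {}"
  using assms less_osuc by (cases "olimit \<alpha>") (auto simp: child_ranks_def olimit_def)

lemma olimit_oadd_iff:
  assumes "0 < \<beta>"
  shows "olimit (\<alpha> + \<beta>) \<longleftrightarrow> olimit \<beta>"
proof
  show "olimit \<beta>" if "olimit (\<alpha> + \<beta>)"
    using that assms by (auto simp: olimit_def oadd_osuc)
next
  assume lim: "olimit \<beta>"
  have pos: "\<alpha> < \<alpha> + \<beta>"
    using assms oadd_less_iff[of \<alpha> 0 \<beta>] by (simp add: oadd_zero)
  have "\<alpha> + \<beta> \<noteq> osuc b" for b
  proof
    assume b: "\<alpha> + \<beta> = osuc b"
    then have "\<alpha> \<le> b"
      using pos by (metis leD le_less_linear osuc_le_iff)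
    then obtain c where c: "b = \<alpha> + c"
      by (rule oadd_subtract)
    then have "\<beta> = osuc c"
      using b by (metis oadd_left_cancel oadd_osuc)
    then show False
      using lim unfolding olimit_def by blast
  qed
  then show "olimit (\<alpha> + \<beta>)"
    using pos zero_le_omega1[of \<alpha>] by (auto simp: olimit_def)
qed

lemma child_ranks_oadd:
  assumes "0 < \<beta>"
  shows "\<alpha> + \<gamma> \<in> child_ranks (\<alpha> + \<beta>) \<longleftrightarrow> \<gamma> \<in> child_ranks \<beta>"
  using olimit_oadd_iff[OF assms, of \<alpha>]
  by (simp add: child_ranks_def oadd_less_iff oadd_left_cancel flip: oadd_osuc)

text \<open>
  At a limit, the required enumeration sends the \<open>k\<close>-th child of rank \<open>\<gamma>\<close> to the pair \<open>(\<gamma>, k)\<close>.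
\<close>

lemma full_tree_NodeI:
  assumes r: "\<And>n. r n \<in> child_ranks \<alpha>" "\<And>n. full_tree (r n) (ts n)"
    and inf: "\<And>\<gamma>. \<gamma> \<in> child_ranks \<alpha> \<Longrightarrow> infinite {n. r n = \<gamma>}"
  shows "full_tree \<alpha> (Node c ts)"
proof (cases "olimit \<alpha>")
  case False
  then have "osuc (r n) = \<alpha>" for n
    using r(1)[of n] by (auto simp: child_ranks_def)
  moreover from this have "r n = r 0" for n
    by (metis osuc_inject)
  ultimately show ?thesis
    using full_tree_osuc[of "r 0" ts c] r(2) by metis
next
  case True
  define h where "h = (\<lambda>(\<gamma>, k). enumerate {n. r n = \<gamma>} k)"
  have inf: "infinite {n. r n = \<gamma>}" if "\<gamma> < \<alpha>" for \<gamma>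
    using inf that True by (simp add: child_ranks_def)
  have lt: "r n < \<alpha>" for n
    using r(1) by (simp add: child_ranks_def)
  have rh: "r (h (\<gamma>, k)) = \<gamma>" if "\<gamma> < \<alpha>" for \<gamma> k
    using enumerate_in_set[OF inf[OF that], of k] by (simp add: h_def)
  have h: "bij_betw h ({..<\<alpha>} \<times> UNIV) UNIV"
    unfolding bij_betw_def
  proof
    show "inj_on h ({..<\<alpha>} \<times> UNIV)"
    proof (rule inj_onI, clarsimp)
      fix \<gamma> k \<gamma>' k'
      assume *: "\<gamma> < \<alpha>" "\<gamma>' < \<alpha>" "h (\<gamma>, k) = h (\<gamma>', k')"
      then have "\<gamma> = \<gamma>'"
        using rh by metis
      then show "\<gamma> = \<gamma>' \<and> k = k'"
        using * inj_enumerate[OF inf] by (auto simp: h_def dest: injD)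
    qed
    have "n \<in> h ` ({..<\<alpha>} \<times> UNIV)" for n
    proof -
      have "n \<in> range (enumerate {m. r m = r n})"
        using range_enumerate[OF inf[OF lt[of n]]] by auto
      then show ?thesis
        using lt[of n] by (auto simp: h_def image_iff)
    qed
    then show "h ` ({..<\<alpha>} \<times> UNIV) = UNIV"
      by auto
  qed
  define e where "e = inv_into ({..<\<alpha>} \<times> UNIV) h"
  have e: "bij_betw e UNIV ({..<\<alpha>} \<times> UNIV)"
    unfolding e_def using h by (rule bij_betw_inv_into)
  have "fst (e n) = r n" for n
  proof -
    have "h (e n) = n"
      unfolding e_def using h by (simp add: bij_betw_inv_into_right)
    moreover have "e n \<in> {..<\<alpha>} \<times> UNIV"
      using e by (auto simp: bij_betw_def)
    ultimately show ?thesis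
      using rh by (metis lessThan_iff mem_Times_iff prod.collapse)
  qed
  then show ?thesis
    using full_tree_limit[OF True e] r(2) by simp
qed

lemma full_tree_NodeE:
  assumes "full_tree \<alpha> t" "0 < \<alpha>"
  obtains c ts r where "t = Node c ts" "\<And>n. r n \<in> child_ranks \<alpha>" "\<And>n. full_tree (r n) (ts n)"
    "\<And>\<gamma>. \<gamma> \<in> child_ranks \<alpha> \<Longrightarrow> infinite {n. r n = \<gamma>}"
  using assms(1)
proof cases
  case (full_tree_zero i)
  then show ?thesis
    using assms(2) by simp
next
  case (full_tree_osuc \<gamma> ts c)
  then have "child_ranks \<alpha> = {\<gamma>}"
    using less_osuc by (auto simp: child_ranks_def olimit_def osuc_inject)
  then show ?thesis
    using full_tree_osuc that[of c ts "\<lambda>_. \<gamma>"] by simp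
next
  case (full_tree_limit e ts c)
  have mem: "fst (e n) < \<alpha>" for n
    using full_tree_limit(3) by (metis UNIV_I bij_betw_apply lessThan_iff mem_Times_iff)
  have "infinite {n. fst (e n) = \<gamma>}" if "\<gamma> < \<alpha>" for \<gamma>
  proof
    assume "finite {n. fst (e n) = \<gamma>}"
    moreover have "{\<gamma>} \<times> (UNIV :: nat set) \<subseteq> e ` {n. fst (e n) = \<gamma>}"
    proof
      fix z assume z: "z \<in> {\<gamma>} \<times> (UNIV :: nat set)"
      then have "z \<in> range e"
        using full_tree_limit(3) that by (auto simp: bij_betw_def)
      then show "z \<in> e ` {n. fst (e n) = \<gamma>}"
        using z by (auto simp: image_iff) (metis fst_conv)
    qed
    ultimately have "finite ({\<gamma>} \<times> (UNIV :: nat set))"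
      by (meson finite_imageI finite_subset)
    then show False
      by (simp add: finite_cartesian_product_iff)
  qed
  then show ?thesis
    using full_tree_limit mem that[of c ts "\<lambda>n. fst (e n)"] by (auto simp: child_ranks_def)
qed

lemma full_tree_zeroE:
  assumes "full_tree 0 t"
  obtains i where "t = Leaf i"
  using assms
proof cases
  case (full_tree_osuc \<gamma> ts c)
  then show ?thesis
    using less_osuc[of \<gamma>] zero_le_omega1[of \<gamma>] by simp
qed (auto simp: olimit_def that)

lemma vars_nonempty: "vars t \<noteq> {}"
  by (induction t) auto

lemma tree_val_cong: "(\<And>i. i \<in> vars t \<Longrightarrow> x i = y i) \<Longrightarrow> tree_val t x = tree_val t y"
proof (induction t)
  case (Node c ts)
  then have "tree_val (ts n) x = tree_val (ts n) y" for n
    by auto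
  then show ?case
    by (simp only: tree_val.simps)
qed simp

lemma tree_val_const: "(\<And>i. i \<in> vars t \<Longrightarrow> x i = b) \<Longrightarrow> tree_val t x = b"
proof (induction t)
  case (Node c ts)
  then have "tree_val (ts n) x = b" for n
    by auto
  then show ?case
    by (simp split: gate.split)
qed simp

text \<open>
  The controlling value of the root gate: one child with this value suffices to give it to the root.
  Statements in terms of \<open>ctrl\<close> hold for both gates at once. The value at a leaf is an arbitrary default.
\<close>

definition ctrl :: "tree \<Rightarrow> bool"
  where "ctrl t \<longleftrightarrow> root_gate t = Some Disj"

lemma tree_val_eq_ctrl:
  "tree_val (Node c ts) x = ctrl (Node c ts) \<longleftrightarrow> (\<exists>n. tree_val (ts n) x = ctrl (Node c ts))"
  by (cases c) (auto simp: ctrl_def)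

text \<open>
  What a restriction leaves of a tree: the root keeps its gate, and each remaining child lies
  inside a child of the original tree of its own. Because of the last condition, giving up one child of
  the original tree costs at most one child of the trimmed tree.
\<close>

definition trims :: "tree \<Rightarrow> tree \<Rightarrow> bool"
  where "trims t' t \<longleftrightarrow> (\<exists>c ts ts' h. t = Node c ts \<and> t' = Node c ts' \<and> inj h \<and>
    (\<forall>k::nat. vars (ts' k) \<subseteq> vars (ts (h k))))"

lemma trims_refl: "trims (Node c ts) (Node c ts)"
  by (auto simp: trims_def intro: exI[of _ id])

lemma trims_trans: "trims t1 t2 \<Longrightarrow> trims t2 t3 \<Longrightarrow> trims t1 t3"
proof -
  assume "trims t1 t2" "trims t2 t3"
  then obtain c ts1 ts2 ts3 h k where "t1 = Node c ts1" "t2 = Node c ts2" "t3 = Node c ts3"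
    "inj h" "inj k" "\<And>n. vars (ts1 n) \<subseteq> vars (ts2 (h n))" "\<And>n. vars (ts2 n) \<subseteq> vars (ts3 (k n))"
    unfolding trims_def by blast
  then show ?thesis
    unfolding trims_def using inj_compose[of k h] by fastforce
qed

lemma trims_vars: "trims t' t \<Longrightarrow> vars t' \<subseteq> vars t"
  by (fastforce simp: trims_def)

lemma trims_root_gate: "trims t' t \<Longrightarrow> root_gate t' = root_gate t"
  by (auto simp: trims_def)

lemma trims_ctrl: "trims t' t \<Longrightarrow> ctrl t' = ctrl t"
  by (simp add: ctrl_def trims_root_gate)

text \<open>
  The way to obtain smaller full trees from larger ones: the children in \<open>M\<close> are replaced by trees \<open>us n\<close>
  on some of their variables, and all other children are deleted. Deleted children do not change the value
  as long as they do not take the controlling value.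
\<close>

lemma reindex_children:
  assumes inj: "inj_leaves (Node c ts)"
    and \<beta>: "0 < \<beta>"
    and r: "\<And>n. n \<in> M \<Longrightarrow> r n \<in> child_ranks \<beta>"
    and us: "\<And>n. n \<in> M \<Longrightarrow> full_alternating_tree (r n) (us n)"
      "\<And>n. n \<in> M \<Longrightarrow> root_gate (us n) \<noteq> Some c"
      "\<And>n. n \<in> M \<Longrightarrow> vars (us n) \<subseteq> vars (ts n)"
    and inf: "\<And>\<gamma>. \<gamma> \<in> child_ranks \<beta> \<Longrightarrow> infinite {n \<in> M. r n = \<gamma>}"
  obtains t' where "full_alternating_tree \<beta> t'" "trims t' (Node c ts)"
    "vars t' = (\<Union>n\<in>M. vars (us n))"
    "\<And>x. tree_val t' x = ctrl (Node c ts) \<longleftrightarrow> (\<exists>n\<in>M. tree_val (us n) x = ctrl (Node c ts))"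
proof -
  obtain \<gamma> where "\<gamma> \<in> child_ranks \<beta>"
    using child_ranks_nonempty[OF \<beta>] by auto
  then have M: "infinite M"
    using inf[of \<gamma>] by (auto elim: infinite_super[rotated])
  define h where "h = enumerate M"
  have h: "range h = M" "inj h"
    unfolding h_def using M by (auto simp: range_enumerate inj_enumerate)
  then have hM: "h n \<in> M" for n
    by auto
  define t' where "t' = Node c (\<lambda>k. us (h k))"
  have "full_tree \<beta> t'"
    unfolding t'_def
  proof (rule full_tree_NodeI)
    show "r (h n) \<in> child_ranks \<beta>" "full_tree (r (h n)) (us (h n))" for n
      using r us(1) hM by (auto simp: full_alternating_tree_def)
    fix \<gamma> assume "\<gamma> \<in> child_ranks \<beta>"
    then have "infinite {n \<in> M. r n = \<gamma>}"
      by (rule inf)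
    moreover have "{n \<in> M. r n = \<gamma>} = h ` {n. r (h n) = \<gamma>}"
      using h(1) by auto
    ultimately show "infinite {n. r (h n) = \<gamma>}"
      by auto
  qed
  moreover have "inj_leaves t'"
  proof -
    have "vars (us (h m)) \<inter> vars (us (h n)) = {}" if "m \<noteq> n" for m n
    proof -
      have "h m \<noteq> h n"
        using h(2) that by (auto dest: injD)
      then have "vars (ts (h m)) \<inter> vars (ts (h n)) = {}"
        using inj by simp
      then show ?thesis
        using us(3)[OF hM] by blast
    qed
    then show ?thesis
      using us(1)[OF hM] by (simp add: t'_def full_alternating_tree_def)
  qed
  moreover have "alternating t'"
    using us(1,2)[OF hM] by (simp add: t'_def full_alternating_tree_def)
  ultimately have "full_alternating_tree \<beta> t'"
    by (simp add: full_alternating_tree_def)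
  moreover have "trims t' (Node c ts)"
    unfolding trims_def t'_def using h(2) us(3)[OF hM] by blast
  moreover have "vars t' = (\<Union>n\<in>M. vars (us n))"
    unfolding t'_def using h(1) by auto
  moreover have "tree_val t' x = ctrl (Node c ts) \<longleftrightarrow> (\<exists>n\<in>M. tree_val (us n) x = ctrl (Node c ts))" for x
  proof -
    have "ctrl t' = ctrl (Node c ts)"
      by (simp add: t'_def ctrl_def)
    then have "tree_val t' x = ctrl (Node c ts) \<longleftrightarrow> (\<exists>k. tree_val (us (h k)) x = ctrl (Node c ts))"
      using tree_val_eq_ctrl[of c "\<lambda>k. us (h k)" x] by (simp add: t'_def)
    then show ?thesis
      using h(1) by auto
  qed
  ultimately show thesis
    using that by blast
qed

section \<open>Restrictions and sets of finite support\<close>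

text \<open>
  The input on which \<open>restr \<rho> f\<close> evaluates \<open>f\<close>. As \<open>overlay \<rho>\<close> maps the whole space \<open>2\<^sup>\<nat>\<close> to itself,
  successive restrictions simply compose, and no subspaces are involved: a restricted set is
  the preimage \<open>overlay \<rho> -` A\<close>.
\<close>

definition overlay :: "restriction \<Rightarrow> (nat \<Rightarrow> bool) \<Rightarrow> nat \<Rightarrow> bool"
  where "overlay \<rho> x i = (case \<rho> i of None \<Rightarrow> x i | Some b \<Rightarrow> b)"

lemma overlay_None [simp]: "\<rho> i = None \<Longrightarrow> overlay \<rho> x i = x i"
  by (simp add: overlay_def)

lemma overlay_Some [simp]: "\<rho> i = Some b \<Longrightarrow> overlay \<rho> x i = b"
  by (simp add: overlay_def)

lemma overlay_add: "overlay (\<rho>' ++ \<rho>) x = overlay \<rho> (overlay \<rho>' x)"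
  by (rule ext) (simp add: overlay_def map_add_def split: option.split)

lemma overlay_le: "\<rho> \<subseteq>\<^sub>m \<rho>' \<Longrightarrow> overlay \<rho> (overlay \<rho>' x) = overlay \<rho>' x"
proof (rule ext)
  fix i
  assume "\<rho> \<subseteq>\<^sub>m \<rho>'"
  then show "overlay \<rho> (overlay \<rho>' x) i = overlay \<rho>' x i"
    by (cases "\<rho> i") (auto simp: overlay_def map_le_def dom_def)
qed

lemma map_le_stages:
  assumes "\<And>n. (\<rho> n :: restriction) \<subseteq>\<^sub>m \<rho> (Suc n)" "m \<le> n"
  shows "\<rho> m \<subseteq>\<^sub>m \<rho> n"
  using assms(2)
proof (induction n rule: dec_induct)
  case (step n)
  then show ?case
    using map_le_trans assms(1) by blast
qed (rule map_le_refl)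

definition depends_on :: "nat set \<Rightarrow> (nat \<Rightarrow> bool) set \<Rightarrow> bool"
  where "depends_on D A \<longleftrightarrow> (\<forall>x y. (\<forall>i\<in>D. x i = y i) \<longrightarrow> (x \<in> A \<longleftrightarrow> y \<in> A))"

text \<open>
  By compactness these are exactly the clopen sets; see \<open>fin_supp_clopen\<close> and \<open>openin_fin_supp\<close>.
\<close>

definition fin_supp :: "(nat \<Rightarrow> bool) set \<Rightarrow> bool"
  where "fin_supp A \<longleftrightarrow> (\<exists>D. finite D \<and> depends_on D A)"

lemma depends_onD: "depends_on D A \<Longrightarrow> (\<And>i. i \<in> D \<Longrightarrow> x i = y i) \<Longrightarrow> x \<in> A \<longleftrightarrow> y \<in> A"
  by (simp add: depends_on_def)

lemma depends_on_overlay: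
  assumes "depends_on D A"
  shows "depends_on (D - dom \<rho>) (overlay \<rho> -` A)"
  unfolding depends_on_def vimage_eq
proof (intro allI impI)
  fix x y :: "nat \<Rightarrow> bool"
  assume "\<forall>i\<in>D - dom \<rho>. x i = y i"
  then have "overlay \<rho> x i = overlay \<rho> y i" if "i \<in> D" for i
    using that by (cases "\<rho> i") (auto simp: domIff)
  then show "overlay \<rho> x \<in> A \<longleftrightarrow> overlay \<rho> y \<in> A"
    by (rule depends_onD[OF assms])
qed

lemma fin_supp_overlay: "fin_supp A \<Longrightarrow> fin_supp (overlay \<rho> -` A)"
  unfolding fin_supp_def using depends_on_overlay finite_Diff by blast

lemma vimage_overlay_le: "\<rho> \<subseteq>\<^sub>m \<rho>' \<Longrightarrow> overlay \<rho>' -` A = overlay \<rho>' -` (overlay \<rho> -` A)"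
  by (simp add: vimage_def overlay_le)

lemma depends_on_mono: "depends_on D A \<Longrightarrow> D \<subseteq> E \<Longrightarrow> depends_on E A"
  by (auto simp: depends_on_def)

lemma depends_on_Compl: "depends_on D (- A) \<longleftrightarrow> depends_on D A"
  by (auto simp: depends_on_def)

lemma fin_supp_Compl: "fin_supp (- A) \<longleftrightarrow> fin_supp A"
  by (simp add: fin_supp_def depends_on_Compl)

section \<open>Borel levels\<close>

text \<open>
  Level \<open>\<alpha>\<close> comprises both Borel classes of rank \<open>\<alpha>\<close>. A restriction makes a set clopen
  iff it makes its complement clopen, so there is no reason to tell the two classes apart, and closing
  the levels under complements leaves a single induction.
\<close>

inductive borel_level :: "omega1 \<Rightarrow> (nat \<Rightarrow> bool) set \<Rightarrow> bool"
  where
    borel_level_fin_supp: "fin_supp A \<Longrightarrow> borel_level \<alpha> A"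
  | borel_level_Compl: "borel_level \<alpha> A \<Longrightarrow> borel_level \<alpha> (- A)"
  | borel_level_INT: "(\<And>n::nat. \<beta> n < \<alpha>) \<Longrightarrow> (\<And>n. borel_level (\<beta> n) (A n)) \<Longrightarrow> borel_level \<alpha> (\<Inter>n. A n)"

lemma borel_level_mono: "borel_level \<alpha> A \<Longrightarrow> \<alpha> \<le> \<beta> \<Longrightarrow> borel_level \<beta> A"
proof (induction rule: borel_level.induct)
  case (borel_level_INT \<gamma> \<alpha> A)
  then show ?case
    using borel_level.borel_level_INT[of \<gamma> \<beta> A] order.strict_trans2 by blast
qed (simp_all add: borel_level.borel_level_fin_supp borel_level.borel_level_Compl)

lemma borel_level_overlay: "borel_level \<alpha> A \<Longrightarrow> borel_level \<alpha> (overlay \<rho> -` A)"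
proof (induction rule: borel_level.induct)
  case (borel_level_INT \<beta> \<alpha> A)
  then show ?case
    using borel_level.borel_level_INT[of \<beta> \<alpha> "\<lambda>n. overlay \<rho> -` A n"] by (simp add: vimage_INT)
qed (simp_all add: borel_level.borel_level_fin_supp borel_level.borel_level_Compl vimage_Compl fin_supp_overlay)

lemma borel_level_zero: "borel_level 0 A \<Longrightarrow> fin_supp A"
proof (induction "0 :: omega1" A rule: borel_level.induct)
  case (borel_level_INT \<beta> A)
  then show ?case
    using zero_le_omega1 by (metis not_less)
qed (simp_all add: fin_supp_Compl)

lemma borel_level_normal_form:
  assumes "borel_level \<alpha> A" "0 < \<alpha>"
  obtains C where "\<And>k::nat. \<exists>\<delta><\<alpha>. borel_level \<delta> (C k)" "A = (\<Inter>k. C k) \<or> - A = (\<Inter>k. C k)"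
proof -
  from assms have "\<exists>C. (\<forall>k::nat. \<exists>\<delta><\<alpha>. borel_level \<delta> (C k)) \<and> (A = (\<Inter>k. C k) \<or> - A = (\<Inter>k. C k))"
  proof (induction rule: borel_level.induct)
    case (borel_level_fin_supp A \<alpha>)
    then have "\<exists>\<delta><\<alpha>. borel_level \<delta> A"
      using borel_level.borel_level_fin_supp by blast
    then show ?case
      by (intro exI[of _ "\<lambda>_. A"]) simp
  next
    case (borel_level_Compl \<alpha> A)
    then obtain C where "\<forall>k::nat. \<exists>\<delta><\<alpha>. borel_level \<delta> (C k)" "A = (\<Inter>k. C k) \<or> - A = (\<Inter>k. C k)"
      by blast
    then show ?case
      by (intro exI[of _ C]) (simp add: disj_commute)
  next
    case (borel_level_INT \<beta> \<alpha> A)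
    then show ?case
      by (intro exI[of _ A]) blast
  qed
  then show thesis
    using that by blast
qed

text \<open>
  The first \<open>\<delta>\<close> steps in the construction of \<open>A\<close> use countably many sets of level \<open>\<delta>\<close>. Where these are
  clopen, the construction starts afresh and takes only \<open>\<eta>\<close> steps.
\<close>

lemma borel_level_split:
  assumes "borel_level (\<delta> + \<eta>) A"
  shows "\<exists>\<C>. countable \<C> \<and> (\<forall>C\<in>\<C>. borel_level \<delta> C) \<and>
    (\<forall>\<rho>. (\<forall>C\<in>\<C>. fin_supp (overlay \<rho> -` C)) \<longrightarrow> borel_level \<eta> (overlay \<rho> -` A))"
  using assms
proof (induction "\<delta> + \<eta>" A arbitrary: \<eta> rule: borel_level.induct)
  case (borel_level_fin_supp A)
  then show ?case
    by (intro exI[of _ "{}"]) (auto intro: borel_level.borel_level_fin_supp fin_supp_overlay)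
next
  case (borel_level_Compl A)
  then show ?case
    using borel_level.borel_level_Compl by (metis vimage_Compl)
next
  case (borel_level_INT \<beta> A)
  show ?case
  proof (cases "\<eta> = 0")
    case True
    have "borel_level \<delta> (\<Inter>n. A n)"
      using borel_level.borel_level_INT[of \<beta> "\<delta> + \<eta>" A] borel_level_INT True by (simp add: oadd_zero)
    then show ?thesis
      by (intro exI[of _ "{\<Inter>n. A n}"]) (auto intro: borel_level.borel_level_fin_supp)
  next
    case False
    have "\<exists>\<C> \<eta>'. \<eta>' < \<eta> \<and> countable \<C> \<and> (\<forall>C\<in>\<C>. borel_level \<delta> C) \<and>
      (\<forall>\<rho>. (\<forall>C\<in>\<C>. fin_supp (overlay \<rho> -` C)) \<longrightarrow> borel_level \<eta>' (overlay \<rho> -` A n))" for n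
    proof (cases "\<beta> n < \<delta>")
      case True
      then have "borel_level \<delta> (A n)"
        using borel_level_INT(2) borel_level_mono by (meson less_imp_le)
      then show ?thesis
        using False zero_le_omega1[of \<eta>]
        by (intro exI[of _ "{A n}"] exI[of _ 0]) (auto intro: borel_level.borel_level_fin_supp)
    next
      case False
      then have "\<delta> \<le> \<beta> n"
        by simp
      then obtain \<eta>' where "\<beta> n = \<delta> + \<eta>'"
        by (rule oadd_subtract)
      then show ?thesis
        using borel_level_INT(1)[of n] borel_level_INT(3)[of n \<eta>'] oadd_less_iff by auto
    qed
    then obtain \<C> \<eta>' where *: "\<And>n. \<eta>' n < \<eta>" "\<And>n. countable (\<C> n)" "\<And>n C. C \<in> \<C> n \<Longrightarrow> borel_level \<delta> C"
      "\<And>n \<rho>. (\<forall>C\<in>\<C> n. fin_supp (overlay \<rho> -` C)) \<Longrightarrow> borel_level (\<eta>' n) (overlay \<rho> -` A n)"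
      by metis
    show ?thesis
      using * by (intro exI[of _ "\<Union>n. \<C> n"]) (auto simp: vimage_INT intro!: borel_level.borel_level_INT[of \<eta>'])
  qed
qed

definition reduces :: "restriction \<Rightarrow> omega1 \<Rightarrow> tree \<Rightarrow> bool"
  where "reduces \<rho> \<beta> t \<longleftrightarrow> (\<exists>t'. full_alternating_tree \<beta> t' \<and> trims t' t \<and> vars t' \<inter> dom \<rho> = {} \<and>
    (\<forall>x. tree_val t (overlay \<rho> x) = tree_val t' x))"

section \<open>Switching\<close>

text \<open>
  The statement to be proved by induction on \<open>\<alpha>\<close>. It speaks of a family of trees because in its own proof
  it has to be applied to infinitely many blocks at the same time; the elements of \<open>I\<close> are mere
  names, and trees will serve as names because a residual tree is named by its original block. The
  ranks \<open>rk s\<close> left over must be positive: if every tree of an infinite family had to become a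
  single variable, then making \<open>{x. \<exists>s\<in>I. \<not> tree_val (t s) x}\<close> clopen would be impossible in general,
  whereas for positive \<open>rk s\<close> most of the subtrees of rank \<open>\<alpha>\<close> may be sacrificed.
\<close>

definition switching :: "omega1 \<Rightarrow> bool"
  where "switching \<alpha> \<longleftrightarrow> (\<forall>\<A> (I :: tree set) t rk.
    countable \<A> \<longrightarrow> (\<forall>A\<in>\<A>. borel_level \<alpha> A) \<longrightarrow>
    (\<forall>s\<in>I. 0 < rk s \<and> full_alternating_tree (\<alpha> + rk s) (t s)) \<longrightarrow>
    disjoint_family_on (\<lambda>s. vars (t s)) I \<longrightarrow>
    (\<exists>\<rho>. (\<forall>A\<in>\<A>. fin_supp (overlay \<rho> -` A)) \<and> (\<forall>s\<in>I. reduces \<rho> (rk s) (t s))))"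

lemma switchingD:
  assumes "switching \<alpha>" "countable \<A>" "\<And>A. A \<in> \<A> \<Longrightarrow> borel_level \<alpha> A"
    "\<And>s. s \<in> I \<Longrightarrow> 0 < rk s" "\<And>s. s \<in> I \<Longrightarrow> full_alternating_tree (\<alpha> + rk s) (t s)"
    "disjoint_family_on (\<lambda>s. vars (t s)) (I :: tree set)"
  obtains \<rho> where "\<And>A. A \<in> \<A> \<Longrightarrow> fin_supp (overlay \<rho> -` A)" "\<And>s. s \<in> I \<Longrightarrow> reduces \<rho> (rk s) (t s)"
proof -
  have "\<exists>\<rho>. (\<forall>A\<in>\<A>. fin_supp (overlay \<rho> -` A)) \<and> (\<forall>s\<in>I. reduces \<rho> (rk s) (t s))"
    using assms(1)[unfolded switching_def, rule_format, of \<A> I rk t] assms(2-) by blast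
  then show thesis
    using that by blast
qed

lemma overlay_empty [simp]: "overlay Map.empty x = x"
  by (simp add: overlay_def fun_eq_iff)

lemma full_tree_pos_Node: "full_tree \<alpha> t \<Longrightarrow> 0 < \<alpha> \<Longrightarrow> \<exists>c ts. t = Node c ts"
  by (metis full_tree_NodeE)

lemma switching_zero: "switching 0"
  unfolding switching_def
proof (intro allI impI)
  fix \<A> :: "(nat \<Rightarrow> bool) set set" and I :: "tree set" and t rk
  assume borel_level: "\<forall>A\<in>\<A>. borel_level 0 A"
    and I: "\<forall>s\<in>I. 0 < rk s \<and> full_alternating_tree (0 + rk s) (t s)"
  have "reduces Map.empty (rk s) (t s)" if "s \<in> I" for s
  proof -
    have "trims (t s) (t s)"
      using I that full_tree_pos_Node[of "rk s" "t s"] trims_refl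
      by (auto simp: full_alternating_tree_def oadd_zero_left)
    then show ?thesis
      using I that unfolding reduces_def by (auto simp: oadd_zero_left)
  qed
  then show "\<exists>\<rho>. (\<forall>A\<in>\<A>. fin_supp (overlay \<rho> -` A)) \<and> (\<forall>s\<in>I. reduces \<rho> (rk s) (t s))"
    using borel_level borel_level_zero by (intro exI[of _ Map.empty]) (auto simp: vimage_def)
qed

text \<open>
  A tree of rank \<open>(\<delta> + \<eta>) + \<beta> = \<delta> + (\<eta> + \<beta>)\<close> first loses \<open>\<delta>\<close> levels and then \<open>\<eta>\<close> levels. The sets to be
  made clopen in the first round are those from which \<open>borel_level_split\<close> builds the given ones.
\<close>

lemma switching_oadd:
  assumes \<delta>: "switching \<delta>" and \<eta>: "switching \<eta>"
  shows "switching (\<delta> + \<eta>)"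
  unfolding switching_def
proof (intro allI impI)
  fix \<A> :: "(nat \<Rightarrow> bool) set set" and I :: "tree set" and t rk
  assume \<A>: "countable \<A>" "\<forall>A\<in>\<A>. borel_level (\<delta> + \<eta>) A"
    and I: "\<forall>s\<in>I. 0 < rk s \<and> full_alternating_tree (\<delta> + \<eta> + rk s) (t s)"
    and disj: "disjoint_family_on (\<lambda>s. vars (t s)) I"
  obtain \<C> where \<C>: "\<And>A. A \<in> \<A> \<Longrightarrow> countable (\<C> A)" "\<And>A C. A \<in> \<A> \<Longrightarrow> C \<in> \<C> A \<Longrightarrow> borel_level \<delta> C"
    "\<And>A \<rho>. A \<in> \<A> \<Longrightarrow> (\<forall>C\<in>\<C> A. fin_supp (overlay \<rho> -` C)) \<Longrightarrow> borel_level \<eta> (overlay \<rho> -` A)"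
    using \<A>(2) borel_level_split[of \<delta> \<eta>] by metis
  obtain \<rho>1 where \<rho>1: "\<And>C. C \<in> (\<Union>A\<in>\<A>. \<C> A) \<Longrightarrow> fin_supp (overlay \<rho>1 -` C)"
    "\<And>s. s \<in> I \<Longrightarrow> reduces \<rho>1 (\<eta> + rk s) (t s)"
  proof (rule switchingD[OF \<delta>, of "\<Union>A\<in>\<A>. \<C> A" I "\<lambda>s. \<eta> + rk s" t])
    show "0 < \<eta> + rk s" if "s \<in> I" for s
      using I that le_oadd_right order.strict_trans2 by blast
  qed (use \<A> \<C> I disj in \<open>auto simp: oadd_assoc\<close>)
  then obtain t' where t': "\<And>s. s \<in> I \<Longrightarrow> full_alternating_tree (\<eta> + rk s) (t' s)"
    "\<And>s. s \<in> I \<Longrightarrow> trims (t' s) (t s)" "\<And>s. s \<in> I \<Longrightarrow> vars (t' s) \<inter> dom \<rho>1 = {}"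
    "\<And>s x. s \<in> I \<Longrightarrow> tree_val (t s) (overlay \<rho>1 x) = tree_val (t' s) x"
    unfolding reduces_def by metis
  obtain \<rho>2 where \<rho>2: "\<And>A. A \<in> (\<lambda>A. overlay \<rho>1 -` A) ` \<A> \<Longrightarrow> fin_supp (overlay \<rho>2 -` A)"
    "\<And>s. s \<in> I \<Longrightarrow> reduces \<rho>2 (rk s) (t' s)"
  proof (rule switchingD[OF \<eta>, of "(\<lambda>A. overlay \<rho>1 -` A) ` \<A>" I rk t'])
    show "disjoint_family_on (\<lambda>s. vars (t' s)) I"
      using disj trims_vars[OF t'(2)] unfolding disjoint_family_on_def by blast
    show "borel_level \<eta> A'" if "A' \<in> (\<lambda>A. overlay \<rho>1 -` A) ` \<A>" for A'
      using that \<C>(3) \<rho>1(1) by blast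
  qed (use \<A>(1) I t'(1) in auto)
  have "reduces (\<rho>2 ++ \<rho>1) (rk s) (t s)" if s: "s \<in> I" for s
  proof -
    obtain t'' where t'': "full_alternating_tree (rk s) t''" "trims t'' (t' s)" "vars t'' \<inter> dom \<rho>2 = {}"
      "\<And>x. tree_val (t' s) (overlay \<rho>2 x) = tree_val t'' x"
      using \<rho>2(2)[OF s] unfolding reduces_def by metis
    moreover have "trims t'' (t s)"
      using t''(2) t'(2)[OF s] by (rule trims_trans)
    moreover have "vars t'' \<inter> dom \<rho>1 = {}"
      using trims_vars[OF t''(2)] t'(3)[OF s] by blast
    ultimately show ?thesis
      unfolding reduces_def using t'(4)[OF s] by (intro exI[of _ t'']) (auto simp: overlay_add)
  qed
  moreover have "fin_supp (overlay (\<rho>2 ++ \<rho>1) -` A)" if "A \<in> \<A>" for A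
    using \<rho>2(1)[of "overlay \<rho>1 -` A"] that by (simp add: vimage_def overlay_add)
  ultimately show "\<exists>\<rho>. (\<forall>A\<in>\<A>. fin_supp (overlay \<rho> -` A)) \<and> (\<forall>s\<in>I. reduces \<rho> (rk s) (t s))"
    by blast
qed

section \<open>Contracting a tree to its blocks\<close>

definition collapsed :: "restriction \<Rightarrow> tree \<Rightarrow> bool"
  where "collapsed \<rho> s \<longleftrightarrow> (\<exists>v \<in> vars s - dom \<rho>. \<forall>x. tree_val s (overlay \<rho> x) = x v)"

definition dead :: "restriction \<Rightarrow> tree \<Rightarrow> bool"
  where "dead \<rho> s \<longleftrightarrow> (\<forall>x. tree_val s (overlay \<rho> x) = ctrl s)"

text \<open>
  The blocks \<open>B\<close> are meant to be the subtrees at which the rank, going down from the root, reaches \<open>\<alpha>\<close>,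
  and each \<open>L \<in> \<L>\<close> consists of the blocks below one parent. The remaining variables belong to
  subtrees of smaller rank, which are switched off by \<open>\<zeta>\<close>. A restriction which collapses infinitely many
  blocks in each \<open>L\<close> and kills the others reduces the tree to rank \<open>\<beta>\<close>. A dead block takes
  the controlling value of its own root; by alternation this does not control its parent.
\<close>

definition contraction ::
    "omega1 \<Rightarrow> omega1 \<Rightarrow> tree \<Rightarrow> tree set \<Rightarrow> tree set set \<Rightarrow> (nat \<Rightarrow> bool) \<Rightarrow> bool"
  where "contraction \<alpha> \<beta> t B \<L> \<zeta> \<longleftrightarrow>
    (\<forall>s\<in>B. full_alternating_tree \<alpha> s \<and> vars s \<subseteq> vars t) \<and> disjoint_family_on vars B \<and>
    countable \<L> \<and> (\<forall>L\<in>\<L>. L \<subseteq> B \<and> infinite L) \<and>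
    (\<forall>\<rho> S. (\<forall>L\<in>\<L>. infinite (S \<inter> L)) \<longrightarrow>
      (\<forall>s\<in>B. if s \<in> S then collapsed \<rho> s else dead \<rho> s) \<longrightarrow>
      (\<forall>i \<in> vars t - \<Union>(vars ` B). \<rho> i = Some (\<zeta> i)) \<longrightarrow> reduces \<rho> \<beta> t)"

text \<open>
  In a tree of rank \<open>\<alpha> + \<beta>\<close>, a child of the root has rank below \<open>\<alpha>\<close> and is switched off, or
  rank \<open>\<alpha>\<close> and is a block, or rank \<open>\<alpha> + \<gamma>\<close> with \<open>0 < \<gamma> < \<beta>\<close> and is contracted recursively. As
  \<open>\<alpha> + \<gamma>\<close> is a child rank of \<open>\<alpha> + \<beta>\<close> iff \<open>\<gamma>\<close> is one of \<open>\<beta>\<close>, what is left has rank \<open>\<beta>\<close>.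
\<close>

lemma ex_contraction:
  assumes \<alpha>: "0 < \<alpha>" and "0 < \<beta>" "full_alternating_tree (\<alpha> + \<beta>) t"
  shows "\<exists>B \<L> \<zeta>. contraction \<alpha> \<beta> t B \<L> \<zeta>"
  using assms(2-)
proof (induction \<beta> arbitrary: t rule: less_induct)
  case (less \<beta>)
  have full: "full_tree (\<alpha> + \<beta>) t" and inj: "inj_leaves t" and alt: "alternating t"
    using less.prems by (auto simp: full_alternating_tree_def)
  have "0 < \<alpha> + \<beta>"
    using less.prems(1) le_oadd_right order.strict_trans2 by blast
  with full obtain c ts r where t: "t = Node c ts" and r: "\<And>n. r n \<in> child_ranks (\<alpha> + \<beta>)"
    "\<And>n. full_tree (r n) (ts n)" "\<And>\<gamma>. \<gamma> \<in> child_ranks (\<alpha> + \<beta>) \<Longrightarrow> infinite {n. r n = \<gamma>}"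
    by (rule full_tree_NodeE) blast
  have fa: "full_alternating_tree (r n) (ts n)" for n
    using inj alt r(2) by (simp add: t full_alternating_tree_def)
  have disj: "m = n" if "i \<in> vars (ts m)" "i \<in> vars (ts n)" for i m n
    using inj that by (auto simp: t)
  define J E G where "J = {n. r n < \<alpha>}" and "E = {n. r n = \<alpha>}" and "G = {n. \<alpha> < r n}"
  have cases: "n \<in> J \<or> n \<in> E \<or> n \<in> G" for n
    by (auto simp: J_def E_def G_def)
  have "\<forall>n. \<exists>\<gamma>. \<alpha> \<le> r n \<longrightarrow> r n = \<alpha> + \<gamma>"
    by (metis oadd_subtract)
  then obtain \<gamma> where \<gamma>: "\<And>n. \<alpha> \<le> r n \<Longrightarrow> r n = \<alpha> + \<gamma> n"
    by metis
  have \<gamma>_child: "\<gamma> n \<in> child_ranks \<beta>" if "\<alpha> \<le> r n" for n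
    using r(1)[of n] \<gamma>[OF that] child_ranks_oadd[OF less.prems(1)] by simp
  have \<gamma>E: "\<gamma> n = 0" if "n \<in> E" for n
    using \<gamma>[of n] that oadd_left_cancel[of \<alpha> "\<gamma> n" 0] by (simp add: E_def oadd_zero)
  have \<gamma>G: "0 < \<gamma> n" if "n \<in> G" for n
    using \<gamma>[of n] that oadd_less_iff[of \<alpha> 0 "\<gamma> n"] by (simp add: G_def oadd_zero)
  have "\<exists>B \<L> \<zeta>. contraction \<alpha> (\<gamma> n) (ts n) B \<L> \<zeta>" if "n \<in> G" for n
  proof (rule less.IH)
    show "\<gamma> n < \<beta>"
      using \<gamma>_child that by (auto simp: G_def child_ranks_def)
    show "full_alternating_tree (\<alpha> + \<gamma> n) (ts n)"
      using fa[of n] \<gamma>[of n] that by (auto simp: G_def)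
  qed (use \<gamma>G that in auto)
  then obtain B \<L> \<zeta> where con: "\<And>n. n \<in> G \<Longrightarrow> contraction \<alpha> (\<gamma> n) (ts n) (B n) (\<L> n) (\<zeta> n)"
    by metis
  have Bvars: "vars s \<subseteq> vars (ts n)" if "n \<in> G" "s \<in> B n" for n s
    using con[OF that(1)] that(2) by (auto simp: contraction_def)
  have Bfull: "full_alternating_tree \<alpha> s" if "n \<in> G" "s \<in> B n" for n s
    using con[OF that(1)] that(2) by (auto simp: contraction_def)
  have \<L>B: "L \<subseteq> B n" "infinite L" if "n \<in> G" "L \<in> \<L> n" for n L
    using con[OF that(1)] that(2) by (auto simp: contraction_def)
  define B' where "B' = ts ` E \<union> (\<Union>n\<in>G. B n)"
  define \<L>' where "\<L>' = (if E = {} then {} else {ts ` E}) \<union> (\<Union>n\<in>G. \<L> n)"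
  define idx where "idx i = (SOME n. i \<in> vars (ts n))" for i
  have idx: "idx i = n" if "i \<in> vars (ts n)" for i n
    unfolding idx_def using that disj by (metis someI)
  define \<zeta>' where "\<zeta>' i = (if idx i \<in> G then \<zeta> (idx i) i else \<not> ctrl t)" for i
  have ts_inj: "inj ts"
    using disj vars_nonempty by (metis equals0I injI)
  have B'_child: "(n \<in> E \<and> s = ts n) \<or> (n \<in> G \<and> s \<in> B n)"
    if "s \<in> B'" "i \<in> vars s" "i \<in> vars (ts n)" for s i n
    using that Bvars disj unfolding B'_def by blast
  have "contraction \<alpha> \<beta> t B' \<L>' \<zeta>'"
    unfolding contraction_def
  proof (intro conjI allI impI)
    show "\<forall>s\<in>B'. full_alternating_tree \<alpha> s \<and> vars s \<subseteq> vars t"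
      using fa Bfull Bvars by (fastforce simp: B'_def t E_def)
    show "disjoint_family_on vars B'"
      unfolding disjoint_family_on_def
    proof (intro ballI impI)
      fix s s' assume s: "s \<in> B'" "s' \<in> B'" "s \<noteq> s'"
      have False if i: "i \<in> vars s" "i \<in> vars s'" for i
      proof -
        obtain n where n: "i \<in> vars (ts n)"
          using s(1) i(1) Bvars unfolding B'_def by blast
        have "n \<in> G \<and> s \<in> B n \<and> s' \<in> B n"
          using B'_child[OF s(1) i(1) n] B'_child[OF s(2) i(2) n] s(3) by (auto simp: E_def G_def)
        then show False
          using con[of n] s(3) i unfolding contraction_def disjoint_family_on_def by blast
      qed
      then show "vars s \<inter> vars s' = {}"
        by blast
    qed
    show "countable \<L>'"
      using con by (auto simp: \<L>'_def contraction_def)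
    have "infinite (ts ` E)" if "n \<in> E" for n
      using r(1)[of n] r(3)[of "r n"] that ts_inj
      by (auto simp: E_def finite_image_iff inj_on_subset)
    then show "\<forall>L\<in>\<L>'. L \<subseteq> B' \<and> infinite L"
      using \<L>B unfolding \<L>'_def B'_def by (auto split: if_splits) (metis subsetD)+
  next
    fix \<rho> S
    assume SL: "\<forall>L\<in>\<L>'. infinite (S \<inter> L)"
      and S: "\<forall>s\<in>B'. if s \<in> S then collapsed \<rho> s else dead \<rho> s"
      and \<rho>: "\<forall>i \<in> vars t - \<Union>(vars ` B'). \<rho> i = Some (\<zeta>' i)"
    have \<rho>: "\<rho> i = Some (\<zeta>' i)" if "i \<in> vars (ts n)" "i \<notin> \<Union>(vars ` B')" for i n
      using \<rho>[rule_format, of i] that by (auto simp: t)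
    define M where "M = G \<union> {n \<in> E. ts n \<in> S}"
    have "\<exists>u. full_alternating_tree (\<gamma> n) u \<and> root_gate u \<noteq> Some c \<and> vars u \<subseteq> vars (ts n) - dom \<rho> \<and>
        (\<forall>x. tree_val (ts n) (overlay \<rho> x) = tree_val u x)" if "n \<in> M" for n
    proof (cases "n \<in> G")
      case True
      have "reduces \<rho> (\<gamma> n) (ts n)"
      proof -
        have "\<forall>i \<in> vars (ts n) - \<Union>(vars ` B n). \<rho> i = Some (\<zeta> n i)"
        proof
          fix i assume i: "i \<in> vars (ts n) - \<Union>(vars ` B n)"
          have "i \<notin> \<Union>(vars ` B')"
            using i B'_child True by (auto simp: E_def G_def)
          moreover have "\<zeta>' i = \<zeta> n i"
            using idx[of i n] i True by (simp add: \<zeta>'_def)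
          ultimately show "\<rho> i = Some (\<zeta> n i)"
            using \<rho>[of i n] i by simp
        qed
        moreover have "\<forall>L\<in>\<L> n. infinite (S \<inter> L)" "\<forall>s\<in>B n. if s \<in> S then collapsed \<rho> s else dead \<rho> s"
          using SL S True unfolding \<L>'_def B'_def by blast+
        ultimately show ?thesis
          using con[OF True] unfolding contraction_def by blast
      qed
      then obtain u where u: "full_alternating_tree (\<gamma> n) u" "trims u (ts n)" "vars u \<inter> dom \<rho> = {}"
        "\<forall>x. tree_val (ts n) (overlay \<rho> x) = tree_val u x"
        unfolding reduces_def by blast
      have "root_gate u \<noteq> Some c"
        using trims_root_gate[OF u(2)] alt by (simp add: t)
      then show ?thesis
        using u trims_vars[OF u(2)] by (intro exI[of _ u]) auto
    next
      case False
      then have n: "n \<in> E" "ts n \<in> S"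
        using that by (auto simp: M_def)
      then have "collapsed \<rho> (ts n)"
        using S by (auto simp: B'_def)
      then obtain v where "v \<in> vars (ts n) - dom \<rho>" "\<forall>x. tree_val (ts n) (overlay \<rho> x) = x v"
        by (auto simp: collapsed_def)
      then show ?thesis
        using \<gamma>E[OF n(1)] by (intro exI[of _ "Leaf v"]) (auto simp: full_alternating_tree_def intro: full_tree.intros)
    qed
    then obtain us where us: "\<And>n. n \<in> M \<Longrightarrow> full_alternating_tree (\<gamma> n) (us n)"
      "\<And>n. n \<in> M \<Longrightarrow> root_gate (us n) \<noteq> Some c" "\<And>n. n \<in> M \<Longrightarrow> vars (us n) \<subseteq> vars (ts n) - dom \<rho>"
      "\<And>n x. n \<in> M \<Longrightarrow> tree_val (ts n) (overlay \<rho> x) = tree_val (us n) x"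
      by metis
    have ge: "\<alpha> \<le> r n" if "n \<in> M" for n
      using that by (auto simp: M_def E_def G_def)
    obtain t' where t': "full_alternating_tree \<beta> t'" "trims t' (Node c ts)"
      "vars t' = (\<Union>n\<in>M. vars (us n))"
      "\<And>x. tree_val t' x = ctrl (Node c ts) \<longleftrightarrow> (\<exists>n\<in>M. tree_val (us n) x = ctrl (Node c ts))"
    proof (rule reindex_children[of c ts \<beta> M \<gamma> us])
      fix \<delta> assume \<delta>: "\<delta> \<in> child_ranks \<beta>"
      then have inf: "infinite {n. r n = \<alpha> + \<delta>}"
        using child_ranks_oadd[OF less.prems(1)] r(3) by blast
      show "infinite {n \<in> M. \<gamma> n = \<delta>}"
      proof (cases "\<delta> = 0")
        case True
        then have "E \<noteq> {}"
          using inf by (auto simp: E_def oadd_zero dest: infinite_imp_nonempty)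
        then have "infinite (S \<inter> ts ` E)"
          using SL by (simp add: \<L>'_def)
        moreover have "S \<inter> ts ` E \<subseteq> ts ` {n \<in> M. \<gamma> n = \<delta>}"
          using True \<gamma>E by (auto simp: M_def)
        ultimately show ?thesis
          by (meson finite_imageI finite_subset)
      next
        case False
        then have "\<alpha> < \<alpha> + \<delta>"
          using oadd_less_iff[of \<alpha> 0 \<delta>] zero_le_omega1[of \<delta>] by (simp add: oadd_zero)
        then have "{n. r n = \<alpha> + \<delta>} \<subseteq> {n \<in> M. \<gamma> n = \<delta>}"
          using \<gamma> by (auto simp: M_def G_def) (metis less_imp_le oadd_left_cancel)
        then show ?thesis
          using inf finite_subset by blast
      qed
    next
      show "vars (us n) \<subseteq> vars (ts n)" if "n \<in> M" for n
        using us(3)[OF that] by blast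
    qed (use us(1,2) ge \<gamma>_child inj less.prems in \<open>auto simp: t\<close>)
    have "tree_val t (overlay \<rho> x) = tree_val t' x" for x
    proof -
      have off: "tree_val (ts n) (overlay \<rho> x) = (\<not> ctrl t)" if "n \<notin> M" for n
      proof (cases "n \<in> J")
        case True
        have "\<rho> i = Some (\<not> ctrl t)" if i: "i \<in> vars (ts n)" for i
        proof -
          have "i \<notin> \<Union>(vars ` B')"
            using i B'_child[of _ i n] True by (fastforce simp: E_def G_def J_def)
          moreover have "\<zeta>' i = (\<not> ctrl t)"
            using idx[OF i] True by (auto simp: \<zeta>'_def G_def J_def)
          ultimately show ?thesis
            using \<rho>[of i n] i by simp
        qed
        then show ?thesis
          by (intro tree_val_const) auto
      next
        case False
        then have n: "n \<in> E" "ts n \<notin> S"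
          using that cases[of n] by (auto simp: M_def)
        then have "dead \<rho> (ts n)"
          using S by (auto simp: B'_def)
        \<comment> \<open>This is where alternation is used: a dead block does not control its parent.\<close>
        moreover have "ctrl (ts n) = (\<not> ctrl t)"
        proof -
          obtain c' ts' where "ts n = Node c' ts'"
            using full_tree_pos_Node[OF r(2)[of n]] \<alpha> n(1) by (auto simp: E_def)
          moreover have "root_gate (ts n) \<noteq> Some c"
            using alt by (simp add: t)
          ultimately show ?thesis
            by (cases c; cases c') (auto simp: t ctrl_def)
        qed
        ultimately show ?thesis
          by (simp add: dead_def)
      qed
      have "tree_val t (overlay \<rho> x) = ctrl t \<longleftrightarrow> (\<exists>n. tree_val (ts n) (overlay \<rho> x) = ctrl t)"
        using tree_val_eq_ctrl[of c ts] by (simp add: t)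
      also have "\<dots> \<longleftrightarrow> (\<exists>n\<in>M. tree_val (us n) x = ctrl t)"
        using off us(4) by metis
      also have "\<dots> \<longleftrightarrow> tree_val t' x = ctrl t"
        using t'(4) by (simp add: t)
      finally show ?thesis
        by blast
    qed
    moreover have "vars t' \<inter> dom \<rho> = {}"
      using t'(3) us(3) by blast
    ultimately show "reduces \<rho> \<beta> t"
      unfolding reduces_def using t'(1,2) by (auto simp: t)
  qed
  then show ?case
    by blast
qed

section \<open>Pruning and collapsing trees\<close>

lemma remove_children:
  assumes t: "full_alternating_tree \<alpha> (Node c ts)" "0 < \<alpha>" and Z: "finite Z"
  obtains t' where "full_alternating_tree \<alpha> t'" "trims t' (Node c ts)"
    "vars t' = (\<Union>n\<in>-Z. vars (ts n))"
    "\<And>x. tree_val (Node c ts) x = ctrl (Node c ts) \<longleftrightarrow>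
      tree_val t' x = ctrl (Node c ts) \<or> (\<exists>n\<in>Z. tree_val (ts n) x = ctrl (Node c ts))"
proof -
  have "full_tree \<alpha> (Node c ts)"
    using t(1) by (simp add: full_alternating_tree_def)
  then obtain r where r: "\<And>n. r n \<in> child_ranks \<alpha>" "\<And>n. full_tree (r n) (ts n)"
    "\<And>\<gamma>. \<gamma> \<in> child_ranks \<alpha> \<Longrightarrow> infinite {n. r n = \<gamma>}"
    using t(2) by (rule full_tree_NodeE) auto
  obtain t' where "full_alternating_tree \<alpha> t'" "trims t' (Node c ts)"
    "vars t' = (\<Union>n\<in>-Z. vars (ts n))"
    "\<And>x. tree_val t' x = ctrl (Node c ts) \<longleftrightarrow> (\<exists>n\<in>-Z. tree_val (ts n) x = ctrl (Node c ts))"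
  proof (rule reindex_children[of c ts \<alpha> "-Z" r ts])
    fix \<gamma> assume "\<gamma> \<in> child_ranks \<alpha>"
    then have "infinite ({n. r n = \<gamma>} - Z)"
      using r(3) Z by (simp add: Diff_infinite_finite)
    moreover have "{n. r n = \<gamma>} - Z = {n \<in> - Z. r n = \<gamma>}"
      by auto
    ultimately show "infinite {n \<in> - Z. r n = \<gamma>}"
      by simp
  qed (use t r in \<open>auto simp: full_alternating_tree_def\<close>)
  moreover from this(4) have "tree_val (Node c ts) x = ctrl (Node c ts) \<longleftrightarrow>
      tree_val t' x = ctrl (Node c ts) \<or> (\<exists>n\<in>Z. tree_val (ts n) x = ctrl (Node c ts))" for x
    unfolding tree_val_eq_ctrl by blast
  ultimately show thesis
    using that by blast
qed

text \<open>
  Along the path to the leaf \<open>v\<close>, all siblings are set to the value that does not control their parent.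
\<close>

lemma collapse_to_leaf:
  assumes "inj_leaves t" "v \<in> vars t"
  shows "\<exists>\<rho>. dom \<rho> = - {v} \<and> (\<forall>x. tree_val t (overlay \<rho> x) = x v)"
  using assms
proof (induction t)
  case (Leaf i)
  then show ?case
    by (intro exI[of _ "\<lambda>j. if j = v then None else Some True"]) (auto simp: dom_def)
next
  case (Node c ts)
  then obtain n where n: "v \<in> vars (ts n)"
    by auto
  then obtain \<rho> where \<rho>: "dom \<rho> = - {v}" "\<And>x. tree_val (ts n) (overlay \<rho> x) = x v"
    using Node.IH[of "ts n"] Node.prems by auto
  define k where "k = ctrl (Node c ts)"
  define \<rho>' where "\<rho>' i = (if i \<in> vars (ts n) then \<rho> i else Some (\<not> k))" for i
  have "tree_val (ts n) (overlay \<rho>' x) = x v" for x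
    using \<rho>(2)[of x] tree_val_cong[of "ts n" "overlay \<rho>' x" "overlay \<rho> x"]
    by (simp add: overlay_def \<rho>'_def)
  moreover have "tree_val (ts m) (overlay \<rho>' x) = (\<not> k)" if "m \<noteq> n" for m x
  proof (rule tree_val_const)
    fix i assume "i \<in> vars (ts m)"
    then have "i \<notin> vars (ts n)"
      using Node.prems(1) that by auto
    then show "overlay \<rho>' x i = (\<not> k)"
      by (simp add: overlay_def \<rho>'_def)
  qed
  ultimately have "tree_val (Node c ts) (overlay \<rho>' x) = k \<longleftrightarrow> x v = k" for x
    using tree_val_eq_ctrl[of c ts "overlay \<rho>' x"] unfolding k_def[symmetric] by metis
  then have "tree_val (Node c ts) (overlay \<rho>' x) = x v" for x
    by blast
  moreover have "dom \<rho>' = - {v}"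
  proof -
    have "\<rho>' i = None \<longleftrightarrow> i = v" for i
      using \<rho>(1) n by (cases "i = v") (auto simp: \<rho>'_def)
    then show ?thesis
      by (auto simp: dom_def)
  qed
  ultimately show ?case
    by blast
qed

lemma dead_mono: "dead \<rho> s \<Longrightarrow> \<rho> \<subseteq>\<^sub>m \<rho>' \<Longrightarrow> dead \<rho>' s"
  unfolding dead_def by (metis overlay_le)

lemma tree_val_overlay_cong:
  "(\<And>i. i \<in> vars t \<Longrightarrow> \<rho> i = \<rho>' i) \<Longrightarrow> tree_val t (overlay \<rho> x) = tree_val t (overlay \<rho>' x)"
  by (rule tree_val_cong) (simp add: overlay_def)

section \<open>Blocks and states\<close>

text \<open>
  The setting of the fusion argument. The rank \<open>\<alpha>\<close> is additively indecomposable, so when switching is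
  applied for \<open>\<delta> < \<alpha>\<close> to trees of rank \<open>\<alpha> = \<delta> + \<alpha>\<close>, trees of rank \<open>\<alpha>\<close> are left over.
\<close>

locale blocks =
  fixes \<alpha> :: omega1 and B :: "tree set"
  assumes pos: "0 < \<alpha>"
    and indecomposable: "\<And>\<delta>. \<delta> < \<alpha> \<Longrightarrow> \<delta> + \<alpha> = \<alpha>"
    and switching_below: "\<And>\<delta>. \<delta> < \<alpha> \<Longrightarrow> switching \<delta>"
    and full: "\<And>s. s \<in> B \<Longrightarrow> full_alternating_tree \<alpha> s"
    and disj: "disjoint_family_on vars B"
begin

text \<open>
  An indecomposable ordinal is \<open>1\<close> or a limit, so every block has infinitely many leaves as children.
\<close>

lemma zero_child: "0 \<in> child_ranks \<alpha>"
proof (cases "olimit \<alpha>")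
  case False
  then obtain \<gamma> where \<gamma>: "\<alpha> = osuc \<gamma>"
    using pos by (auto simp: olimit_def)
  then have "osuc (\<gamma> + \<gamma>) = osuc (\<gamma> + 0)"
    using indecomposable[of \<gamma>] less_osuc by (simp add: oadd_osuc oadd_zero)
  then have "\<gamma> = 0"
    by (simp add: osuc_inject oadd_left_cancel)
  then show ?thesis
    using \<gamma> less_osuc by (simp add: child_ranks_def)
qed (use pos in \<open>auto simp: child_ranks_def\<close>)

lemma block_eq: "s \<in> B \<Longrightarrow> s' \<in> B \<Longrightarrow> i \<in> vars s \<Longrightarrow> i \<in> vars s' \<Longrightarrow> s = s'"
  using disj by (auto simp: disjoint_family_on_def)

lemma block_Node:
  assumes "full_alternating_tree \<alpha> s"
  obtains c ts where "s = Node c ts"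
  using assms pos full_tree_pos_Node unfolding full_alternating_tree_def by blast

lemma finite_blocks_meeting:
  assumes "finite F"
  shows "finite {s \<in> B. F \<inter> vars s \<noteq> {}}"
proof -
  have "{s \<in> B. F \<inter> vars s \<noteq> {}} \<subseteq> (\<lambda>i. THE s. s \<in> B \<and> i \<in> vars s) ` F"
  proof
    fix s assume "s \<in> {s \<in> B. F \<inter> vars s \<noteq> {}}"
    then obtain i where i: "s \<in> B" "i \<in> F" "i \<in> vars s"
      by auto
    then have "(THE s. s \<in> B \<and> i \<in> vars s) = s"
      using block_eq by blast
    then show "s \<in> (\<lambda>i. THE s. s \<in> B \<and> i \<in> vars s) ` F"
      using i by (intro image_eqI[of _ _ i]) simp_all
  qed
  then show ?thesis
    using assms finite_surj by blast
qed

text \<open>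
  Under \<open>\<rho>\<close> the block \<open>s\<close> has become the gate at its root applied to \<open>\<tau>\<close> and to the stars of the block.
  Keeping a full tree \<open>\<tau>\<close> of rank \<open>\<alpha>\<close> next to the star means that the block can still be given the
  controlling value, whatever the value of the star.
\<close>

definition residual :: "restriction \<Rightarrow> nat set \<Rightarrow> tree \<Rightarrow> tree \<Rightarrow> bool"
  where "residual \<rho> V s \<tau> \<longleftrightarrow> full_alternating_tree \<alpha> \<tau> \<and> trims \<tau> s \<and> vars \<tau> \<inter> (dom \<rho> \<union> V) = {} \<and>
    (\<forall>x. tree_val s (overlay \<rho> x) = ctrl s \<longleftrightarrow> tree_val \<tau> x = ctrl s \<or> (\<exists>v \<in> V \<inter> vars s. x v = ctrl s))"

definition live :: "restriction \<Rightarrow> nat set \<Rightarrow> tree \<Rightarrow> bool"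
  where "live \<rho> V s \<longleftrightarrow> (\<exists>\<tau>. residual \<rho> V s \<tau>)"

lemma residualD:
  assumes "residual \<rho> V s \<tau>"
  shows "full_alternating_tree \<alpha> \<tau>" "trims \<tau> s" "vars \<tau> \<inter> (dom \<rho> \<union> V) = {}"
    "\<And>x. tree_val s (overlay \<rho> x) = ctrl s \<longleftrightarrow> tree_val \<tau> x = ctrl s \<or> (\<exists>v \<in> V \<inter> vars s. x v = ctrl s)"
  using assms unfolding residual_def by blast+

text \<open>
  The stages of the construction: \<open>\<rho>\<close> is the restriction so far, and \<open>V\<close> contains the variables promised
  to remain unrestricted forever. Since the damage done at any stage is finite, an
  infinite set of blocks always contains a live one without a star.
\<close>

definition state :: "restriction \<Rightarrow> nat set \<Rightarrow> bool"
  where "state \<rho> V \<longleftrightarrow> finite V \<and> V \<inter> dom \<rho> = {} \<and>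
    (\<forall>s\<in>B. \<forall>v \<in> V \<inter> vars s. \<forall>w \<in> V \<inter> vars s. v = w) \<and>
    (\<forall>s\<in>B. live \<rho> V s \<or> dead \<rho> s \<and> V \<inter> vars s = {}) \<and>
    finite {s \<in> B. \<not> live \<rho> V s}"

lemma state_finite: "state \<rho> V \<Longrightarrow> finite V"
  and state_disjoint: "state \<rho> V \<Longrightarrow> V \<inter> dom \<rho> = {}"
  and state_unique: "state \<rho> V \<Longrightarrow> s \<in> B \<Longrightarrow> v \<in> V \<Longrightarrow> v \<in> vars s \<Longrightarrow> w \<in> V \<Longrightarrow> w \<in> vars s \<Longrightarrow> v = w"
  and state_cases: "state \<rho> V \<Longrightarrow> s \<in> B \<Longrightarrow> live \<rho> V s \<or> dead \<rho> s \<and> V \<inter> vars s = {}"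
  and state_finite_not_live: "state \<rho> V \<Longrightarrow> finite {s \<in> B. \<not> live \<rho> V s}"
  unfolding state_def by simp_all

text \<open>
  A live block takes the non-controlling value when all its variables do.
\<close>

lemma live_not_dead:
  assumes "live \<rho> V s"
  shows "\<not> dead \<rho> s"
proof
  let ?x = "\<lambda>_. \<not> ctrl s"
  assume "dead \<rho> s"
  then have val: "tree_val s (overlay \<rho> ?x) = ctrl s"
    unfolding dead_def by blast
  obtain \<tau> where "residual \<rho> V s \<tau>"
    using assms unfolding live_def by blast
  note \<tau> = residualD[OF this]
  have "tree_val \<tau> ?x = ctrl s"
    using \<tau>(4)[of ?x] val by blast
  moreover have "tree_val \<tau> ?x = (\<not> ctrl s)"
    by (rule tree_val_const) (rule refl)
  ultimately show False
    by blast
qed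

lemma live_cong:
  assumes "\<And>i. i \<in> vars s \<Longrightarrow> \<rho> i = \<rho>' i" "V \<inter> vars s = V' \<inter> vars s" "live \<rho> V s"
  shows "live \<rho>' V' s"
proof -
  obtain \<tau> where "residual \<rho> V s \<tau>"
    using assms(3) unfolding live_def by blast
  note \<tau> = residualD[OF this]
  have "i \<notin> dom \<rho>' \<union> V'" if "i \<in> vars \<tau>" for i
  proof -
    have "i \<in> vars s" "i \<notin> dom \<rho>" "i \<notin> V"
      using that \<tau>(3) trims_vars[OF \<tau>(2)] by auto
    then show ?thesis
      using assms(1)[of i] assms(2) by (auto simp: domIff)
  qed
  moreover have "tree_val s (overlay \<rho> x) = tree_val s (overlay \<rho>' x)" for x
    using assms(1) by (rule tree_val_overlay_cong)
  ultimately show ?thesis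
    unfolding live_def residual_def using \<tau>(1,2,4) assms(2) by (intro exI[of _ \<tau>]) auto
qed

lemma dead_cong: "(\<And>i. i \<in> vars s \<Longrightarrow> \<rho> i = \<rho>' i) \<Longrightarrow> dead \<rho> s \<Longrightarrow> dead \<rho>' s"
  unfolding dead_def using tree_val_overlay_cong by blast

section \<open>Fixing variables\<close>

text \<open>
  The sets of variables that can be fixed at will, at the cost of finitely many blocks: each live block
  has only finitely many children that are met by such a set. Besides finite sets, a child
  of a block is small; this matters when the children of the starred blocks are closed one by one.
\<close>

definition small :: "nat set \<Rightarrow> bool"
  where "small D \<longleftrightarrow> finite {s \<in> B. D \<inter> vars s \<noteq> {}} \<and>
    (\<forall>c ts. Node c ts \<in> B \<longrightarrow> finite {n. D \<inter> vars (ts n) \<noteq> {}})"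

lemma block_children_disjoint:
  "full_alternating_tree \<alpha> (Node c ts) \<Longrightarrow> i \<in> vars (ts m) \<Longrightarrow> i \<in> vars (ts n) \<Longrightarrow> m = n"
  unfolding full_alternating_tree_def inj_leaves.simps by blast

lemma small_finite:
  assumes "finite D"
  shows "small D"
proof -
  have "finite {n. D \<inter> vars (ts n) \<noteq> {}}" if s: "Node c ts \<in> B" for c ts
  proof -
    have "{n. D \<inter> vars (ts n) \<noteq> {}} \<subseteq> (\<lambda>i. THE n. i \<in> vars (ts n)) ` D"
    proof
      fix n assume "n \<in> {n. D \<inter> vars (ts n) \<noteq> {}}"
      then obtain i where i: "i \<in> D" "i \<in> vars (ts n)"
        by auto
      then have "(THE n. i \<in> vars (ts n)) = n"
        using block_children_disjoint[OF full[OF s]] by blast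
      then show "n \<in> (\<lambda>i. THE n. i \<in> vars (ts n)) ` D"
        using i by (intro image_eqI[of _ _ i]) simp_all
    qed
    then show ?thesis
      using assms finite_surj by blast
  qed
  then show ?thesis
    using finite_blocks_meeting[OF assms] by (simp add: small_def)
qed

lemma small_child:
  assumes s: "Node c ts \<in> B"
  shows "small (vars (ts n))"
proof -
  have "{s \<in> B. vars (ts n) \<inter> vars s \<noteq> {}} \<subseteq> {Node c ts}"
    using block_eq[OF _ s] by auto
  moreover have "{m. vars (ts n) \<inter> vars (ts' m) \<noteq> {}} \<subseteq> {n}" if s': "Node c' ts' \<in> B" for c' ts'
  proof
    fix m assume "m \<in> {m. vars (ts n) \<inter> vars (ts' m) \<noteq> {}}"
    then obtain i where i: "i \<in> vars (ts n)" "i \<in> vars (ts' m)"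
      by blast
    then have "Node c' ts' = Node c ts"
      using block_eq[OF s' s, of i] by auto
    then show "m \<in> {n}"
      using block_children_disjoint[OF full[OF s]] i by simp
  qed
  ultimately show ?thesis
    unfolding small_def by (meson finite.emptyI finite.insertI finite_subset)
qed

lemma small_trims:
  assumes "small D" "s \<in> B" "trims (Node c ts) s"
  shows "finite {k. D \<inter> vars (ts k) \<noteq> {}}"
proof -
  obtain ts' h where h: "s = Node c ts'" "inj h" "\<And>k. vars (ts k) \<subseteq> vars (ts' (h k))"
    using assms(3) by (auto simp: trims_def)
  have "finite {n. D \<inter> vars (ts' n) \<noteq> {}}"
    using assms(1,2) h(1) by (auto simp: small_def)
  moreover have "h ` {k. D \<inter> vars (ts k) \<noteq> {}} \<subseteq> {n. D \<inter> vars (ts' n) \<noteq> {}}"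
    using h(3) by blast
  ultimately show ?thesis
    using h(2) by (meson finite_imageD finite_subset inj_on_subset subset_UNIV)
qed

text \<open>
  There are three cases. A block with a star in \<open>V\<close> must stay live; the children of its residual
  that meet \<open>D\<close> are given the non-controlling value, as prescribed by \<open>y\<close>, and are dropped. A block without
  a star in \<open>V\<close> that meets \<open>D\<close> or contains a star that is being given up is killed: one child of
  its residual which does not meet \<open>D\<close> enforces the controlling value no matter what \<open>y\<close> does
  elsewhere. All other blocks are left alone.
\<close>

lemma settle_block:
  assumes st: "state \<rho> V'" "V \<subseteq> V'" and D: "small D" and s: "s \<in> B"
    and y: "\<And>i. V \<inter> vars s \<noteq> {} \<Longrightarrow> i \<in> vars s - V \<Longrightarrow> y i = (\<not> ctrl s)"
  obtains \<pi> where "\<And>i. i \<in> D \<inter> vars s - V - dom \<rho> \<Longrightarrow> \<pi> i = Some (y i)" "dom \<pi> \<inter> V = {}"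
    "live (\<pi> ++ \<rho>) V s \<or> dead (\<pi> ++ \<rho>) s \<and> V \<inter> vars s = {}"
    "live \<rho> V' s \<Longrightarrow> V \<inter> vars s \<noteq> {} \<or> (D \<union> V') \<inter> vars s = {} \<Longrightarrow> live (\<pi> ++ \<rho>) V s"
proof (cases "V \<inter> vars s = {}")
  case False
  then have V': "V' \<inter> vars s = V \<inter> vars s"
  proof -
    obtain v where v: "v \<in> V" "v \<in> vars s"
      using False by blast
    then have "w = v" if "w \<in> V'" "w \<in> vars s" for w
      using state_unique[OF st(1) s that] st(2) by blast
    then show ?thesis
      using v st(2) by blast
  qed
  have "live \<rho> V' s"
    using state_cases[OF st(1) s] False V' by blast
  then obtain \<tau> where "residual \<rho> V' s \<tau>"
    unfolding live_def by blast
  note \<tau> = residualD[OF this]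
  obtain c ts where Node: "\<tau> = Node c ts"
    using \<tau>(1) by (rule block_Node)
  have ctrl: "ctrl (Node c ts) = ctrl s"
    using \<tau>(2) trims_ctrl Node by blast
  \<comment> \<open>The children in \<open>Z\<close> will be set to the non-controlling value and dropped.\<close>
  define Z where "Z = {k. D \<inter> vars (ts k) \<noteq> {}}"
  have Z: "finite Z"
    unfolding Z_def using D s \<tau>(2) Node by (blast intro: small_trims)
  obtain \<tau>' where \<tau>': "full_alternating_tree \<alpha> \<tau>'" "trims \<tau>' \<tau>" "vars \<tau>' = (\<Union>n\<in>-Z. vars (ts n))"
    "\<And>x. tree_val \<tau> x = ctrl s \<longleftrightarrow> tree_val \<tau>' x = ctrl s \<or> (\<exists>n\<in>Z. tree_val (ts n) x = ctrl s)"
    using remove_children[OF \<tau>(1)[unfolded Node] pos Z] unfolding Node[symmetric] ctrl[folded Node] by metis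
  define U where "U = (vars s - V - dom \<rho>) \<inter> (D \<union> (\<Union>k\<in>Z. vars (ts k)))"
  define \<pi> where "\<pi> i = (if i \<in> U then Some (\<not> ctrl s) else None)" for i
  have dom: "dom \<pi> = U"
    by (auto simp: \<pi>_def dom_def)
  have ts_s: "vars (ts k) \<subseteq> vars s - V' - dom \<rho>" for k
    using trims_vars[OF \<tau>(2)] \<tau>(3) by (auto simp: Node)
  have U\<tau>': "vars \<tau>' \<inter> U = {}"
    using block_children_disjoint[OF \<tau>(1)[unfolded Node]] unfolding \<tau>'(3) U_def Z_def by blast
  have p3: "live (\<pi> ++ \<rho>) V s"
    unfolding live_def residual_def
  proof (intro exI[of _ \<tau>'] conjI allI)
    show "trims \<tau>' s"
      using \<tau>'(2) \<tau>(2) by (rule trims_trans)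
    show "vars \<tau>' \<inter> (dom (\<pi> ++ \<rho>) \<union> V) = {}"
      using U\<tau>' \<tau>(3) trims_vars[OF \<tau>'(2)] st(2) by (auto simp: dom)
    fix x
    have "tree_val (ts k) (overlay \<pi> x) = (\<not> ctrl s)" if "k \<in> Z" for k
    proof (rule tree_val_const)
      fix i assume i: "i \<in> vars (ts k)"
      then have "i \<in> U"
        using ts_s[of k] that st(2) by (auto simp: U_def)
      then show "overlay \<pi> x i = (\<not> ctrl s)"
        by (simp add: \<pi>_def overlay_def)
    qed
    moreover have "tree_val \<tau>' (overlay \<pi> x) = tree_val \<tau>' x"
      using U\<tau>' by (intro tree_val_cong) (auto simp: \<pi>_def overlay_def)
    moreover have "overlay \<pi> x v = x v" if "v \<in> V" for v
      using that by (simp add: \<pi>_def overlay_def U_def)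
    ultimately show "tree_val s (overlay (\<pi> ++ \<rho>) x) = ctrl s \<longleftrightarrow>
        tree_val \<tau>' x = ctrl s \<or> (\<exists>v \<in> V \<inter> vars s. x v = ctrl s)"
      unfolding overlay_add \<tau>(4) \<tau>'(4) V' by auto
  qed (rule \<tau>'(1))
  have p1: "\<pi> i = Some (y i)" if "i \<in> D \<inter> vars s - V - dom \<rho>" for i
    using y[OF False] that by (simp add: \<pi>_def U_def)
  have p2: "dom \<pi> \<inter> V = {}"
    unfolding dom U_def by blast
  show ?thesis
    by (rule that[OF p1 p2 disjI1[OF p3] p3])
next
  case V: True
  show ?thesis
  proof (cases "(D \<union> V') \<inter> vars s = {}")
    case True
    have live: "live (Map.empty ++ \<rho>) V s" if "live \<rho> V' s"
      by (rule live_cong[of s \<rho> _ V']) (use that V True in auto)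
    show ?thesis
    proof (rule that[of Map.empty])
      show "live (Map.empty ++ \<rho>) V s \<or> dead (Map.empty ++ \<rho>) s \<and> V \<inter> vars s = {}"
        using live state_cases[OF st(1) s] V by auto
    qed (use live True in auto)
  next
    case touched: False
    show ?thesis
    proof (cases "live \<rho> V' s")
      case False
      then have "dead \<rho> s"
        using state_cases[OF st(1) s] by blast
      define \<pi> where "\<pi> i = (if i \<in> vars s then Some (y i) else None)" for i
      have p3: "dead (\<pi> ++ \<rho>) s"
        using \<open>dead \<rho> s\<close> by (rule dead_mono) simp
      have p2: "dom \<pi> \<inter> V = {}"
        using V by (auto simp: \<pi>_def split: if_splits)
      have p1: "\<pi> i = Some (y i)" if "i \<in> D \<inter> vars s - V - dom \<rho>" for i
        using that by (simp add: \<pi>_def)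
      show ?thesis
        by (rule that[OF p1 p2]) (use p3 V False in simp_all)
    next
      case True
      then obtain \<tau> where "residual \<rho> V' s \<tau>"
        unfolding live_def by blast
      note \<tau> = residualD[OF this]
      obtain c ts where Node: "\<tau> = Node c ts"
        using \<tau>(1) by (rule block_Node)
      have ctrl: "ctrl (Node c ts) = ctrl s"
        using \<tau>(2) trims_ctrl Node by blast
      have "finite {k. D \<inter> vars (ts k) \<noteq> {}}"
        using D s \<tau>(2) Node by (blast intro: small_trims)
      then have "{k. D \<inter> vars (ts k) \<noteq> {}} \<noteq> UNIV"
        by (metis infinite_UNIV_nat)
      \<comment> \<open>This child is free to impose the controlling value.\<close>
      then obtain k where k: "D \<inter> vars (ts k) = {}"
        by blast
      define \<pi> where "\<pi> i = (if i \<in> vars (ts k) then Some (ctrl s) else if i \<in> vars s then Some (y i) else None)" for i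
      have k_s: "vars (ts k) \<subseteq> vars s"
        using trims_vars[OF \<tau>(2)] by (auto simp: Node)
      have p3: "dead (\<pi> ++ \<rho>) s"
        unfolding dead_def
      proof
        fix x
        have "tree_val (ts k) (overlay \<pi> x) = ctrl s"
          by (rule tree_val_const) (simp add: \<pi>_def overlay_def)
        then have "tree_val \<tau> (overlay \<pi> x) = ctrl s"
          using tree_val_eq_ctrl[of c ts] ctrl Node by metis
        then show "tree_val s (overlay (\<pi> ++ \<rho>) x) = ctrl s"
          unfolding overlay_add \<tau>(4) by blast
      qed
      have p1: "\<pi> i = Some (y i)" if "i \<in> D \<inter> vars s - V - dom \<rho>" for i
        using k that by (auto simp: \<pi>_def)
      have "dom \<pi> \<subseteq> vars s"
        using k_s by (auto simp: \<pi>_def split: if_splits)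
      then have p2: "dom \<pi> \<inter> V = {}"
        using V by blast
      show ?thesis
        by (rule that[OF p1 p2]) (use p3 V touched in simp_all)
    qed
  qed
qed

text \<open>
  The variables in \<open>D\<close> are fixed as prescribed by \<open>y\<close>, and the stars outside \<open>V\<close> are given up. Applied with
  \<open>V = V'\<close>, it extends a state; with \<open>V\<close> smaller, it carries an achievement of a
  state with more stars back to the stars \<open>V\<close>.
\<close>

lemma settle:
  assumes st: "state \<rho> V'" "V \<subseteq> V'" and D: "small D"
    and y: "\<And>s i. s \<in> B \<Longrightarrow> V \<inter> vars s \<noteq> {} \<Longrightarrow> i \<in> vars s - V \<Longrightarrow> y i = (\<not> ctrl s)"
  obtains \<rho>' where "\<rho> \<subseteq>\<^sub>m \<rho>'" "state \<rho>' V" "D \<subseteq> dom \<rho>' \<union> V"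
    "\<And>i. i \<in> D - V - dom \<rho> \<Longrightarrow> \<rho>' i = Some (y i)"
proof -
  define P where "P s \<pi> \<longleftrightarrow> (\<forall>i \<in> D \<inter> vars s - V - dom \<rho>. \<pi> i = Some (y i)) \<and> dom \<pi> \<inter> V = {} \<and>
    (live (\<pi> ++ \<rho>) V s \<or> dead (\<pi> ++ \<rho>) s \<and> V \<inter> vars s = {}) \<and>
    (live \<rho> V' s \<longrightarrow> V \<inter> vars s \<noteq> {} \<or> (D \<union> V') \<inter> vars s = {} \<longrightarrow> live (\<pi> ++ \<rho>) V s)" for s \<pi>
  have "\<forall>s\<in>B. \<exists>\<pi>. P s \<pi>"
  proof
    fix s assume s: "s \<in> B"
    show "\<exists>\<pi>. P s \<pi>"
      by (rule settle_block[OF st D s y[OF s]]) (blast, blast, unfold P_def, blast)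
  qed
  from bchoice[OF this] obtain \<pi> where "\<forall>s\<in>B. P s (\<pi> s)"
    by (rule exE)
  then have \<pi>: "P s (\<pi> s)" if "s \<in> B" for s
    using that by blast
  have \<pi>1: "\<pi> s i = Some (y i)" if "s \<in> B" "i \<in> D \<inter> vars s - V - dom \<rho>" for s i
    using \<pi>[OF that(1)] that(2) unfolding P_def by blast
  have \<pi>2: "dom (\<pi> s) \<inter> V = {}" if "s \<in> B" for s
    using \<pi>[OF that] unfolding P_def by blast
  have \<pi>3: "live (\<pi> s ++ \<rho>) V s \<or> dead (\<pi> s ++ \<rho>) s \<and> V \<inter> vars s = {}" if "s \<in> B" for s
    using \<pi>[OF that] unfolding P_def by blast
  have \<pi>4: "live (\<pi> s ++ \<rho>) V s"
    if "s \<in> B" "live \<rho> V' s" "V \<inter> vars s \<noteq> {} \<or> (D \<union> V') \<inter> vars s = {}" for s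
    using \<pi>[OF that(1)] that(2,3) unfolding P_def by blast
  define \<pi>' where "\<pi>' i = (if \<exists>s\<in>B. i \<in> vars s then \<pi> (THE s. s \<in> B \<and> i \<in> vars s) i
    else if i \<in> D - V then Some (y i) else None)" for i
  have \<pi>': "\<pi>' i = \<pi> s i" if "s \<in> B" "i \<in> vars s" for s i
  proof -
    have "(THE s. s \<in> B \<and> i \<in> vars s) = s"
      using that block_eq by blast
    then show ?thesis
      using that by (auto simp: \<pi>'_def)
  qed
  define \<rho>' where "\<rho>' = \<pi>' ++ \<rho>"
  have \<rho>'_s: "(\<pi> s ++ \<rho>) i = \<rho>' i" if "s \<in> B" "i \<in> vars s" for s i
    using \<pi>'[OF that] by (simp add: \<rho>'_def map_add_def split: option.split)
  have D': "\<rho>' i = Some (y i)" if i: "i \<in> D - V - dom \<rho>" for i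
  proof (cases "\<exists>s\<in>B. i \<in> vars s")
    case True
    then show ?thesis
      using \<pi>1 \<pi>' i by (auto simp: \<rho>'_def map_add_def domIff)
  next
    case False
    then show ?thesis
      using i by (auto simp: \<rho>'_def map_add_def domIff \<pi>'_def)
  qed
  have live: "live \<rho>' V s" if "s \<in> B" "live (\<pi> s ++ \<rho>) V s" for s
    using \<rho>'_s[OF that(1)] refl that(2) by (rule live_cong)
  have dead: "dead \<rho>' s" if "s \<in> B" "dead (\<pi> s ++ \<rho>) s" for s
    using \<rho>'_s[OF that(1)] that(2) by (rule dead_cong)
  have "state \<rho>' V"
    unfolding state_def
  proof (intro conjI)
    show "finite V"
      using state_finite[OF st(1)] st(2) by (rule finite_subset[rotated])
    show "V \<inter> dom \<rho>' = {}"
    proof -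
      have "\<pi>' i = None" if "i \<in> V" for i
      proof (cases "\<exists>s\<in>B. i \<in> vars s")
        case True
        then show ?thesis
          using \<pi>2 \<pi>' that by (metis disjoint_iff domIff)
      qed (use that in \<open>auto simp: \<pi>'_def\<close>)
      then show ?thesis
        using state_disjoint[OF st(1)] st(2) by (auto simp: \<rho>'_def)
    qed
    show "\<forall>s\<in>B. \<forall>v\<in>V \<inter> vars s. \<forall>w\<in>V \<inter> vars s. v = w"
      using state_unique[OF st(1)] st(2) by blast
    show "\<forall>s\<in>B. live \<rho>' V s \<or> dead \<rho>' s \<and> V \<inter> vars s = {}"
      using \<pi>3 live dead by blast
    have "{s \<in> B. \<not> live \<rho>' V s} \<subseteq>
        {s \<in> B. \<not> live \<rho> V' s} \<union> ({s \<in> B. D \<inter> vars s \<noteq> {}} \<union> {s \<in> B. V' \<inter> vars s \<noteq> {}})"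
      using \<pi>4 live by blast
    moreover have "finite \<dots>"
      using state_finite_not_live[OF st(1)] D finite_blocks_meeting[OF state_finite[OF st(1)]]
      by (simp add: small_def)
    ultimately show "finite {s \<in> B. \<not> live \<rho>' V s}"
      by (rule finite_subset)
  qed
  moreover have "D \<subseteq> dom \<rho>' \<union> V"
    using D' by (fastforce simp: \<rho>'_def)
  ultimately show thesis
    using that[of \<rho>'] D' by (simp add: \<rho>'_def)
qed

lemma state_None: "state \<rho> V \<Longrightarrow> i \<in> V \<Longrightarrow> \<rho> i = None"
  using state_disjoint by (auto simp: disjoint_iff domIff)

section \<open>Stars and determined sets\<close>

text \<open>
  A child of the residual which is a leaf becomes a star. The other children still form a full tree.
\<close>

lemma promote:
  assumes st: "state \<rho> V" and s: "s \<in> B" "live \<rho> V s" "V \<inter> vars s = {}"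
  obtains v where "v \<in> vars s" "state \<rho> (insert v V)"
proof -
  obtain \<tau> where "residual \<rho> V s \<tau>"
    using s(2) unfolding live_def by blast
  note \<tau> = residualD[OF this]
  have "full_tree \<alpha> \<tau>"
    using \<tau>(1) by (simp add: full_alternating_tree_def)
  then obtain c ts r where Node: "\<tau> = Node c ts" and r: "\<And>n. full_tree (r n) (ts n)"
    "\<And>\<gamma>. \<gamma> \<in> child_ranks \<alpha> \<Longrightarrow> infinite {n. r n = \<gamma>}"
    using pos by (rule full_tree_NodeE) blast
  obtain n where "r n = 0"
    using infinite_imp_nonempty[OF r(2)[OF zero_child]] by blast
  then obtain v where v: "ts n = Leaf v"
    using r(1)[of n] full_tree_zeroE by metis
  have ctrl: "ctrl (Node c ts) = ctrl s"
    using trims_ctrl[OF \<tau>(2)] Node by simp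
  obtain \<tau>' where \<tau>': "full_alternating_tree \<alpha> \<tau>'" "trims \<tau>' \<tau>" "vars \<tau>' = (\<Union>m\<in>-{n}. vars (ts m))"
    "\<And>x. tree_val \<tau> x = ctrl s \<longleftrightarrow> tree_val \<tau>' x = ctrl s \<or> (\<exists>m\<in>{n}. tree_val (ts m) x = ctrl s)"
    using remove_children[OF \<tau>(1)[unfolded Node] pos, of "{n}"] unfolding Node[symmetric] ctrl[folded Node] by blast
  have v\<tau>: "v \<in> vars \<tau>"
    using v by (auto simp: Node intro!: exI[of _ n])
  then have v_s: "v \<in> vars s" "v \<notin> dom \<rho>"
    using trims_vars[OF \<tau>(2)] \<tau>(3) by auto
  have "v \<notin> vars \<tau>'"
    using block_children_disjoint[OF \<tau>(1)[unfolded Node], of v n] v by (auto simp: \<tau>'(3))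
  have V_s: "insert v V \<inter> vars s = {v}"
    using s(3) v_s(1) by auto
  have "residual \<rho> (insert v V) s \<tau>'"
    unfolding residual_def
  proof (intro conjI allI)
    show "trims \<tau>' s"
      using \<tau>'(2) \<tau>(2) by (rule trims_trans)
    show "vars \<tau>' \<inter> (dom \<rho> \<union> insert v V) = {}"
      using \<open>v \<notin> vars \<tau>'\<close> \<tau>(3) trims_vars[OF \<tau>'(2)] by blast
    fix x
    show "tree_val s (overlay \<rho> x) = ctrl s \<longleftrightarrow>
        tree_val \<tau>' x = ctrl s \<or> (\<exists>v \<in> insert v V \<inter> vars s. x v = ctrl s)"
      unfolding \<tau>(4)[of x] \<tau>'(4)[of x] V_s s(3) by (simp add: v)
  qed (rule \<tau>'(1))
  then have live_s: "live \<rho> (insert v V) s"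
    unfolding live_def by blast
  have other: "v \<notin> vars s'" if "s' \<in> B" "s' \<noteq> s" for s'
    using block_eq[OF that(1) s(1)] that(2) v_s(1) by blast
  have live: "live \<rho> (insert v V) s'" if "s' \<in> B" "live \<rho> V s'" for s'
  proof (cases "s' = s")
    case True
    then show ?thesis
      using live_s by simp
  next
    case False
    then have "V \<inter> vars s' = insert v V \<inter> vars s'"
      using other[OF that(1)] by blast
    from refl this that(2) show ?thesis
      by (rule live_cong)
  qed
  have "state \<rho> (insert v V)"
    unfolding state_def
  proof (intro conjI ballI)
    show "finite (insert v V)"
      using state_finite[OF st] by simp
    show "insert v V \<inter> dom \<rho> = {}"
      using state_disjoint[OF st] v_s(2) by blast
    show "v' = w" if "s' \<in> B" "v' \<in> insert v V \<inter> vars s'" "w \<in> insert v V \<inter> vars s'" for s' v' w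
    proof (cases "s' = s")
      case True
      then have "v' \<in> {v}" "w \<in> {v}"
        using that(2,3) V_s by simp_all
      then show ?thesis
        by simp
    next
      case False
      then show ?thesis
        using that other[OF that(1) False] state_unique[OF st that(1), of v' w] by blast
    qed
    show "live \<rho> (insert v V) s' \<or> dead \<rho> s' \<and> insert v V \<inter> vars s' = {}" if "s' \<in> B" for s'
    proof (cases "s' = s")
      case True
      then show ?thesis
        using live_s by simp
    next
      case False
      then show ?thesis
        using state_cases[OF st that] live[OF that] other[OF that False] by blast
    qed
    have "{s' \<in> B. \<not> live \<rho> (insert v V) s'} \<subseteq> {s' \<in> B. \<not> live \<rho> V s'}"
      using live by blast
    then show "finite {s' \<in> B. \<not> live \<rho> (insert v V) s'}"
      using state_finite_not_live[OF st] by (rule finite_subset)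
  qed
  then show thesis
    using that v_s(1) by blast
qed

text \<open>
  The value that does not control the root of the block containing \<open>i\<close>.
\<close>

definition neutral :: "nat \<Rightarrow> bool"
  where "neutral i \<longleftrightarrow> \<not> ctrl (THE s. s \<in> B \<and> i \<in> vars s)"

lemma neutral: "s \<in> B \<Longrightarrow> i \<in> vars s \<Longrightarrow> neutral i = (\<not> ctrl s)"
proof -
  assume "s \<in> B" "i \<in> vars s"
  moreover from this have "(THE s. s \<in> B \<and> i \<in> vars s) = s"
    using block_eq by blast
  ultimately show ?thesis
    by (simp add: neutral_def)
qed

text \<open>
  The residuals of the live blocks are trees of rank \<open>\<alpha> = \<delta> + \<alpha>\<close>, so switching for \<open>\<delta>\<close> turns them
  into trees of rank \<open>\<alpha>\<close>. Stars do not occur in the residuals; they are exempted from the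
  restriction afterwards.
\<close>

lemma switch_live:
  assumes st: "state \<rho> V" and \<delta>: "\<delta> < \<alpha>" and \<A>: "countable \<A>" "\<And>A. A \<in> \<A> \<Longrightarrow> borel_level \<delta> A"
  obtains \<pi> where "state (\<pi> |` (- V) ++ \<rho>) V" "\<And>A. A \<in> \<A> \<Longrightarrow> fin_supp (overlay \<pi> -` A)"
proof -
  define I where "I = {s \<in> B. live \<rho> V s}"
  have "\<forall>s\<in>I. \<exists>\<tau>. residual \<rho> V s \<tau>"
    unfolding I_def live_def by blast
  from bchoice[OF this] obtain \<tau> where "\<forall>s\<in>I. residual \<rho> V s (\<tau> s)"
    by (rule exE)
  then have \<tau>: "residual \<rho> V s (\<tau> s)" if "s \<in> I" for s
    using that by blast
  have \<tau>_s: "vars (\<tau> s) \<subseteq> vars s" if "s \<in> I" for s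
    using residualD(2)[OF \<tau>[OF that]] by (rule trims_vars)
  obtain \<pi> where \<pi>: "\<And>A. A \<in> \<A> \<Longrightarrow> fin_supp (overlay \<pi> -` A)" "\<And>s. s \<in> I \<Longrightarrow> reduces \<pi> \<alpha> (\<tau> s)"
  proof (rule switchingD[OF switching_below[OF \<delta>] \<A>, of I "\<lambda>_. \<alpha>" \<tau>])
    show "full_alternating_tree (\<delta> + \<alpha>) (\<tau> s)" if "s \<in> I" for s
      using residualD(1)[OF \<tau>[OF that]] indecomposable[OF \<delta>] by simp
    show "disjoint_family_on (\<lambda>s. vars (\<tau> s)) I"
      using disj \<tau>_s unfolding disjoint_family_on_def I_def by blast
  qed (use pos in auto)
  define \<pi>' where "\<pi>' = \<pi> |` (- V)"
  have live: "live (\<pi>' ++ \<rho>) V s" if s: "s \<in> I" for s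
  proof -
    note \<tau> = residualD[OF \<tau>[OF s]]
    obtain t' where t': "full_alternating_tree \<alpha> t'" "trims t' (\<tau> s)" "vars t' \<inter> dom \<pi> = {}"
      "\<forall>x. tree_val (\<tau> s) (overlay \<pi> x) = tree_val t' x"
      using \<pi>(2)[OF s] unfolding reduces_def by blast
    have "residual (\<pi>' ++ \<rho>) V s t'"
      unfolding residual_def
    proof (intro conjI allI)
      show "trims t' s"
        using t'(2) \<tau>(2) by (rule trims_trans)
      have aux: "W \<inter> (D \<union> V) = {}"
        if "D \<subseteq> P \<union> R" "W \<subseteq> T" "W \<inter> P = {}" "T \<inter> (R \<union> V) = {}" for W D P R T :: "nat set"
        using that by blast
      have "dom (\<pi>' ++ \<rho>) \<subseteq> dom \<pi> \<union> dom \<rho>"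
        by (auto simp: \<pi>'_def)
      from this trims_vars[OF t'(2)] t'(3) \<tau>(3) show "vars t' \<inter> (dom (\<pi>' ++ \<rho>) \<union> V) = {}"
        by (rule aux)
      fix x
      have "tree_val (\<tau> s) (overlay \<pi>' x) = tree_val (\<tau> s) (overlay \<pi> x)"
      proof (rule tree_val_overlay_cong)
        fix i assume "i \<in> vars (\<tau> s)"
        then have "i \<notin> V"
          using \<tau>(3) by blast
        then show "\<pi>' i = \<pi> i"
          by (simp add: \<pi>'_def)
      qed
      then have 1: "tree_val (\<tau> s) (overlay \<pi>' x) = tree_val t' x"
        using t'(4)[rule_format, of x] by (rule trans)
      have 2: "(\<exists>v \<in> V \<inter> vars s. overlay \<pi>' x v = ctrl s) \<longleftrightarrow> (\<exists>v \<in> V \<inter> vars s. x v = ctrl s)"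
        by (rule bex_cong[OF refl]) (simp add: \<pi>'_def)
      show "tree_val s (overlay (\<pi>' ++ \<rho>) x) = ctrl s \<longleftrightarrow>
          tree_val t' x = ctrl s \<or> (\<exists>v \<in> V \<inter> vars s. x v = ctrl s)"
        by (simp only: overlay_add \<tau>(4) 1 2)
    qed (rule t'(1))
    then show ?thesis
      unfolding live_def by blast
  qed
  have "state (\<pi>' ++ \<rho>) V"
    unfolding state_def
  proof (intro conjI ballI)
    show "finite V"
      by (rule state_finite[OF st])
    show "V \<inter> dom (\<pi>' ++ \<rho>) = {}"
      using state_disjoint[OF st] by (auto simp: \<pi>'_def)
    show "v = w" if "s \<in> B" "v \<in> V \<inter> vars s" "w \<in> V \<inter> vars s" for s v w
      using state_unique[OF st that(1)] that(2,3) by blast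
    show "live (\<pi>' ++ \<rho>) V s \<or> dead (\<pi>' ++ \<rho>) s \<and> V \<inter> vars s = {}" if "s \<in> B" for s
    proof (cases "s \<in> I")
      case False
      then have "dead \<rho> s" "V \<inter> vars s = {}"
        using state_cases[OF st that] that unfolding I_def by blast+
      then show ?thesis
        using dead_mono[of \<rho> s "\<pi>' ++ \<rho>"] by simp
    qed (use live in simp)
    have "{s \<in> B. \<not> live (\<pi>' ++ \<rho>) V s} \<subseteq> {s \<in> B. \<not> live \<rho> V s}"
      using live unfolding I_def by blast
    then show "finite {s \<in> B. \<not> live (\<pi>' ++ \<rho>) V s}"
      using state_finite_not_live[OF st] by (rule finite_subset)
  qed
  then show thesis
    using that[of \<pi>] \<pi>(1) unfolding \<pi>'_def by simp
qed

text \<open>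
  Since the restriction \<open>\<pi>\<close> provided by \<open>switch_live\<close> may fix stars, it is applied to
  the finitely many sets \<open>A \<sigma>\<close>, which arise from \<open>C\<close> by assigning the values \<open>\<sigma>\<close> to the stars. On the cylinder
  of \<open>\<sigma>\<close>, the restriction \<open>\<pi>\<close> without its values on \<open>V\<close> acts on \<open>C\<close> as \<open>\<pi>\<close> acts on \<open>A \<sigma>\<close>. The finite
  support obtained in this way is then settled.
\<close>

lemma determine:
  assumes st: "state \<rho> V" and C: "\<delta> < \<alpha>" "borel_level \<delta> C"
  obtains \<rho>' where "\<rho> \<subseteq>\<^sub>m \<rho>'" "state \<rho>' V" "depends_on V (overlay \<rho>' -` C)"
proof -
  define asg where "asg \<sigma> i = (if i \<in> V then Some (i \<in> \<sigma>) else None)" for \<sigma> i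
  define A where "A \<sigma> = overlay (asg \<sigma>) -` (overlay \<rho> -` C)" for \<sigma>
  have V: "finite V"
    by (rule state_finite[OF st])
  have "borel_level \<delta> (A \<sigma>)" for \<sigma>
    unfolding A_def by (intro borel_level_overlay C(2))
  then obtain \<pi> where \<pi>: "state (\<pi> |` (- V) ++ \<rho>) V"
    "\<And>E. E \<in> A ` Pow V \<Longrightarrow> fin_supp (overlay \<pi> -` E)"
    using switch_live[OF st C(1), of "A ` Pow V"] V by (metis (no_types, lifting) countable_finite finite_Pow_iff finite_imageI imageE)
  define \<rho>1 where "\<rho>1 = \<pi> |` (- V) ++ \<rho>"
  have "\<forall>\<sigma>\<in>Pow V. \<exists>D. finite D \<and> depends_on D (overlay \<pi> -` A \<sigma>)"
    using \<pi>(2) unfolding fin_supp_def by blast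
  from bchoice[OF this] obtain D where D: "\<forall>\<sigma>\<in>Pow V. finite (D \<sigma>) \<and> depends_on (D \<sigma>) (overlay \<pi> -` A \<sigma>)"
    by (rule exE)
  define E where "E = V \<union> (\<Union>\<sigma>\<in>Pow V. D \<sigma>)"
  have "finite E"
    unfolding E_def using V D by blast
  have C_iff: "x \<in> overlay \<rho>1 -` C \<longleftrightarrow> x \<in> overlay \<pi> -` A {i \<in> V. x i}" for x
  proof -
    have "overlay (\<pi> |` (- V)) x = overlay (asg {i \<in> V. x i}) (overlay \<pi> x)"
      by (rule ext) (simp add: overlay_def asg_def restrict_map_def)
    then show ?thesis
      by (simp add: \<rho>1_def A_def overlay_add)
  qed
  have depends_on: "depends_on E (overlay \<rho>1 -` C)"
    unfolding depends_on_def
  proof (intro allI impI)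
    fix x y :: "nat \<Rightarrow> bool"
    assume xy: "\<forall>i\<in>E. x i = y i"
    then have \<sigma>: "{i \<in> V. x i} = {i \<in> V. y i}"
      by (auto simp: E_def)
    have "{i \<in> V. y i} \<in> Pow V"
      by blast
    then have "depends_on (D {i \<in> V. y i}) (overlay \<pi> -` A {i \<in> V. y i})" "D {i \<in> V. y i} \<subseteq> E"
      using D unfolding E_def by blast+
    then have "x \<in> overlay \<pi> -` A {i \<in> V. y i} \<longleftrightarrow> y \<in> overlay \<pi> -` A {i \<in> V. y i}"
      using xy by (intro depends_onD) auto
    then show "x \<in> overlay \<rho>1 -` C \<longleftrightarrow> y \<in> overlay \<rho>1 -` C"
      unfolding C_iff \<sigma> .
  qed
  obtain \<rho>2 where \<rho>2: "\<rho>1 \<subseteq>\<^sub>m \<rho>2" "state \<rho>2 V" "E \<subseteq> dom \<rho>2 \<union> V"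
  proof (rule settle[of \<rho>1 V V E neutral])
    show "state \<rho>1 V"
      unfolding \<rho>1_def by (rule \<pi>(1))
    show "small E"
      using \<open>finite E\<close> by (rule small_finite)
  qed (use neutral in auto)
  have "depends_on (E - dom \<rho>2) (overlay \<rho>2 -` C)"
    using depends_on_overlay[OF depends_on, of \<rho>2] unfolding vimage_overlay_le[OF \<rho>2(1), of C] .
  then have "depends_on V (overlay \<rho>2 -` C)"
    by (rule depends_on_mono) (use \<rho>2(3) in \<open>simp add: Diff_subset_conv\<close>)
  moreover have "\<rho> \<subseteq>\<^sub>m \<rho>2"
    using \<rho>2(1) map_le_trans unfolding \<rho>1_def by (metis map_le_map_add)
  ultimately show thesis
    using that \<rho>2(2) by blast
qed

section \<open>Deciding intersections\<close>

text \<open>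
  In a block with a star in \<open>V\<close> the residual is bound to be set to the non-controlling value in the end.
  Only inputs of this kind are relevant when the future of a state is considered.
\<close>

definition neutral_off :: "nat set \<Rightarrow> (nat \<Rightarrow> bool) \<Rightarrow> bool"
  where "neutral_off V y \<longleftrightarrow> (\<forall>s\<in>B. V \<inter> vars s \<noteq> {} \<longrightarrow> (\<forall>i \<in> vars s - V. y i = (\<not> ctrl s)))"

text \<open>
  An assignment to \<open>V\<close> is given by the set \<open>\<sigma>\<close> of the variables with value true. The intersection of the
  sets \<open>C k\<close> is decided on the cylinder of \<open>\<sigma>\<close> negatively if one of them misses the cylinder,
  and positively if no extension of the state, with stars added or not, that determines some \<open>C k\<close> can
  keep a relevant input in the cylinder out of \<open>C k\<close>.
\<close>

definition excluded :: "restriction \<Rightarrow> nat set \<Rightarrow> nat set \<Rightarrow> (nat \<Rightarrow> (nat \<Rightarrow> bool) set) \<Rightarrow> bool"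
  where "excluded \<rho> V \<sigma> C \<longleftrightarrow> (\<exists>k. \<forall>x. {i \<in> V. x i} = \<sigma> \<longrightarrow> overlay \<rho> x \<notin> C k)"

definition included :: "restriction \<Rightarrow> nat set \<Rightarrow> nat set \<Rightarrow> (nat \<Rightarrow> (nat \<Rightarrow> bool) set) \<Rightarrow> bool"
  where "included \<rho> V \<sigma> C \<longleftrightarrow>
    (\<forall>\<rho>' V' k y. \<rho> \<subseteq>\<^sub>m \<rho>' \<longrightarrow> V \<subseteq> V' \<longrightarrow> state \<rho>' V' \<longrightarrow> depends_on V' (overlay \<rho>' -` C k) \<longrightarrow>
      {i \<in> V. y i} = \<sigma> \<longrightarrow> neutral_off V y \<longrightarrow> overlay \<rho>' y \<in> C k)"

definition resolved :: "restriction \<Rightarrow> nat set \<Rightarrow> nat set \<Rightarrow> (nat \<Rightarrow> (nat \<Rightarrow> bool) set) \<Rightarrow> bool"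
  where "resolved \<rho> V \<sigma> C \<longleftrightarrow> excluded \<rho> V \<sigma> C \<or> included \<rho> V \<sigma> C"

lemma includedD:
  assumes "included \<rho> V \<sigma> C" "\<rho> \<subseteq>\<^sub>m \<rho>'" "V \<subseteq> V'" "state \<rho>' V'" "depends_on V' (overlay \<rho>' -` C k)"
    "{i \<in> V. y i} = \<sigma>" "neutral_off V y"
  shows "overlay \<rho>' y \<in> C k"
  using assms(1)[unfolded included_def, rule_format, OF assms(2-7)] .

lemma excluded_mono:
  assumes ex: "excluded \<rho> V \<sigma> C" and le: "\<rho> \<subseteq>\<^sub>m \<rho>'" and V: "V \<inter> dom \<rho>' = {}"
  shows "excluded \<rho>' V \<sigma> C"
proof -
  obtain k where k: "\<forall>x. {i \<in> V. x i} = \<sigma> \<longrightarrow> overlay \<rho> x \<notin> C k"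
    using ex unfolding excluded_def by (rule exE)
  have "overlay \<rho>' x \<notin> C k" if x: "{i \<in> V. x i} = \<sigma>" for x
  proof -
    have "overlay \<rho>' x i = x i" if "i \<in> V" for i
    proof (rule overlay_None)
      show "\<rho>' i = None"
        using V that by (auto simp: disjoint_iff domIff)
    qed
    then have "{i \<in> V. overlay \<rho>' x i} = {i \<in> V. x i}"
      by (intro Collect_cong conj_cong) simp_all
    then have "overlay \<rho> (overlay \<rho>' x) \<notin> C k"
      using k[rule_format, of "overlay \<rho>' x"] x by simp
    then show ?thesis
      unfolding overlay_le[OF le] .
  qed
  then show ?thesis
    unfolding excluded_def by (intro exI allI impI)
qed

lemma resolved_mono:
  assumes "resolved \<rho> V \<sigma> C" "\<rho> \<subseteq>\<^sub>m \<rho>'" "V \<inter> dom \<rho>' = {}"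
  shows "resolved \<rho>' V \<sigma> C"
proof (cases "excluded \<rho> V \<sigma> C")
  case True
  then show ?thesis
    unfolding resolved_def using excluded_mono assms(2,3) by blast
next
  case False
  then have *: "included \<rho> V \<sigma> C"
    using assms(1) unfolding resolved_def by blast
  have "included \<rho>' V \<sigma> C"
    unfolding included_def
    by (intro allI impI, rule includedD[OF * map_le_trans[OF assms(2)]])
  then show ?thesis
    unfolding resolved_def by blast
qed

text \<open>
  If \<open>\<sigma>\<close> is not positively decided, then there are an extension with stars \<open>V'\<close> and a relevant input \<open>y\<close> outside
  some \<open>C k\<close> that depends on \<open>V'\<close> only. Settling \<open>V'\<close> according to \<open>y\<close>, with the stars outside \<open>V\<close> given up,
  keeps the entire cylinder of \<open>\<sigma>\<close> outside \<open>C k\<close>.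
\<close>

lemma resolve_one:
  assumes st: "state \<rho> V"
  obtains \<rho>' where "\<rho> \<subseteq>\<^sub>m \<rho>'" "state \<rho>' V" "resolved \<rho>' V \<sigma> C"
proof (cases "resolved \<rho> V \<sigma> C")
  case True
  then show ?thesis
    using that[OF map_le_refl st] by blast
next
  case False
  then have "\<not> included \<rho> V \<sigma> C"
    unfolding resolved_def by blast
  then obtain \<rho>' V' k y where *: "\<rho> \<subseteq>\<^sub>m \<rho>'" "V \<subseteq> V'" "state \<rho>' V'" "depends_on V' (overlay \<rho>' -` C k)"
    "{i \<in> V. y i} = \<sigma>" "neutral_off V y" "overlay \<rho>' y \<notin> C k"
    unfolding included_def not_all not_imp by (elim exE conjE) (rule that)
  obtain \<rho>2 where \<rho>2: "\<rho>' \<subseteq>\<^sub>m \<rho>2" "state \<rho>2 V" "V' \<subseteq> dom \<rho>2 \<union> V"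
    "\<And>i. i \<in> V' - V - dom \<rho>' \<Longrightarrow> \<rho>2 i = Some (y i)"
  proof (rule settle[OF *(3,2) small_finite[OF state_finite[OF *(3)]], of y])
    show "y i = (\<not> ctrl s)" if "s \<in> B" "V \<inter> vars s \<noteq> {}" "i \<in> vars s - V" for s i
      using *(6) that unfolding neutral_off_def by blast
  qed blast
  have "overlay \<rho>2 x \<notin> C k" if x: "{i \<in> V. x i} = \<sigma>" for x
  proof -
    have "overlay \<rho>2 x i = y i" if "i \<in> V'" for i
    proof (cases "i \<in> V")
      case True
      then have "\<rho>2 i = None"
        using state_None[OF \<rho>2(2)] by simp
      moreover have "x i = y i"
        using x *(5) True by blast
      ultimately show ?thesis
        by simp
    next
      case False
      then show ?thesis
        using \<rho>2(4)[of i] that state_None[OF *(3) that] by (simp add: domIff)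
    qed
    then have "overlay \<rho>2 x \<in> overlay \<rho>' -` C k \<longleftrightarrow> y \<in> overlay \<rho>' -` C k"
      by (rule depends_onD[OF *(4)])
    then show ?thesis
      using *(7) overlay_le[OF \<rho>2(1), of x] by simp
  qed
  then have "excluded \<rho>2 V \<sigma> C"
    unfolding excluded_def by blast
  then have "resolved \<rho>2 V \<sigma> C"
    unfolding resolved_def ..
  then show ?thesis
    using that[OF map_le_trans[OF *(1) \<rho>2(1)] \<rho>2(2)] by blast
qed

lemma resolve:
  assumes "state \<rho> V"
  obtains \<rho>' where "\<rho> \<subseteq>\<^sub>m \<rho>'" "state \<rho>' V" "\<And>\<sigma>. \<sigma> \<subseteq> V \<Longrightarrow> resolved \<rho>' V \<sigma> C"
proof -
  have "\<exists>\<rho>'. \<rho> \<subseteq>\<^sub>m \<rho>' \<and> state \<rho>' V \<and> (\<forall>\<sigma>\<in>\<Sigma>. resolved \<rho>' V \<sigma> C)" if "finite \<Sigma>" for \<Sigma>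
    using that
  proof (induction \<Sigma>)
    case empty
    then show ?case
      using assms map_le_refl by blast
  next
    case (insert \<sigma> \<Sigma>)
    then obtain \<rho>1 where \<rho>1: "\<rho> \<subseteq>\<^sub>m \<rho>1" "state \<rho>1 V" "\<forall>\<sigma>\<in>\<Sigma>. resolved \<rho>1 V \<sigma> C"
      by blast
    obtain \<rho>2 where \<rho>2: "\<rho>1 \<subseteq>\<^sub>m \<rho>2" "state \<rho>2 V" "resolved \<rho>2 V \<sigma> C"
      using \<rho>1(2) by (rule resolve_one)
    have "\<forall>\<sigma>\<in>\<Sigma>. resolved \<rho>2 V \<sigma> C"
      using \<rho>1(3) resolved_mono[OF _ \<rho>2(1) state_disjoint[OF \<rho>2(2)]] by blast
    then show ?case
      using \<rho>2 map_le_trans[OF \<rho>1(1) \<rho>2(1)] by blast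
  qed
  from this[of "Pow V"] show thesis
    using that state_finite[OF assms] by (auto simp: Pow_def)
qed

section \<open>Fusion\<close>

text \<open>
  The tasks of one stage: to star a block from \<open>L\<close>; to decide the fate of the block \<open>s\<close>, and, if it has
  a star, to close its \<open>n\<close>-th child; to determine the set \<open>C\<close> of lower level; and to decide the
  intersection of the sets \<open>A k\<close>.
\<close>

definition handled :: "tree set \<Rightarrow> tree \<Rightarrow> nat \<Rightarrow> (nat \<Rightarrow> bool) set \<Rightarrow> (nat \<Rightarrow> (nat \<Rightarrow> bool) set) \<Rightarrow>
    restriction \<times> nat set \<Rightarrow> restriction \<times> nat set \<Rightarrow> bool"
  where "handled L s n C A S S' \<longleftrightarrow> (case (S, S') of ((\<rho>, V), (\<rho>', V')) \<Rightarrow>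
    \<rho> \<subseteq>\<^sub>m \<rho>' \<and> V \<subseteq> V' \<and>
    (infinite L \<and> L \<subseteq> B \<longrightarrow> (\<exists>s\<in>L. V \<inter> vars s = {} \<and> V' \<inter> vars s \<noteq> {})) \<and>
    (s \<in> B \<longrightarrow> dead \<rho>' s \<or> V' \<inter> vars s \<noteq> {} \<and>
      (\<forall>c ts. s = Node c ts \<longrightarrow> vars (ts n) \<subseteq> dom \<rho>' \<union> V')) \<and>
    ((\<exists>\<delta><\<alpha>. borel_level \<delta> C) \<longrightarrow> depends_on V' (overlay \<rho>' -` C)) \<and>
    (\<forall>\<sigma>\<subseteq>V'. resolved \<rho>' V' \<sigma> A))"

lemma handle:
  assumes st: "state \<rho> V"
  shows "\<exists>\<rho>' V'. state \<rho>' V' \<and> handled L s n C A (\<rho>, V) (\<rho>', V')"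
proof -
  obtain V1 where V1: "V \<subseteq> V1" "state \<rho> V1"
    "infinite L \<and> L \<subseteq> B \<longrightarrow> (\<exists>s\<in>L. V \<inter> vars s = {} \<and> V1 \<inter> vars s \<noteq> {})"
  proof (cases "infinite L \<and> L \<subseteq> B")
    case True
    have "finite ({s \<in> B. \<not> live \<rho> V s} \<union> {s \<in> B. V \<inter> vars s \<noteq> {}})"
      using state_finite_not_live[OF st] finite_blocks_meeting[OF state_finite[OF st]] by blast
    then have "\<not> L \<subseteq> {s \<in> B. \<not> live \<rho> V s} \<union> {s \<in> B. V \<inter> vars s \<noteq> {}}"
      using True finite_subset by blast
    then obtain s where s: "s \<in> L" "s \<in> B" "live \<rho> V s" "V \<inter> vars s = {}"
      using True by blast
    obtain v where "v \<in> vars s" "state \<rho> (insert v V)"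
      using st s(2-) by (rule promote)
    then show ?thesis
      using that[of "insert v V"] s by blast
  next
    case False
    then show ?thesis
      using that[of V] st by blast
  qed
  obtain \<rho>2 V2 where 2: "V1 \<subseteq> V2" "\<rho> \<subseteq>\<^sub>m \<rho>2" "state \<rho>2 V2"
    "s \<in> B \<longrightarrow> dead \<rho>2 s \<or> V2 \<inter> vars s \<noteq> {} \<and> (\<forall>c ts. s = Node c ts \<longrightarrow> vars (ts n) \<subseteq> dom \<rho>2 \<union> V2)"
  proof (cases "s \<in> B \<and> \<not> dead \<rho> s")
    case True
    then have s: "s \<in> B" "live \<rho> V1 s"
      using state_cases[OF V1(2)] by blast+
    obtain V2 where V2: "V1 \<subseteq> V2" "state \<rho> V2" "V2 \<inter> vars s \<noteq> {}"
    proof (cases "V1 \<inter> vars s = {}")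
      case True
      obtain v where "v \<in> vars s" "state \<rho> (insert v V1)"
        using V1(2) s True by (rule promote)
      then show ?thesis
        using that[of "insert v V1"] by blast
    next
      case False
      then show ?thesis
        using that[of V1] V1(2) by blast
    qed
    obtain c ts where Node: "s = Node c ts"
      using full[OF s(1)] by (rule block_Node)
    obtain \<rho>2 where "\<rho> \<subseteq>\<^sub>m \<rho>2" "state \<rho>2 V2" "vars (ts n) \<subseteq> dom \<rho>2 \<union> V2"
    proof (rule settle[OF V2(2) subset_refl, of "vars (ts n)" neutral])
      show "small (vars (ts n))"
        using s(1) unfolding Node by (rule small_child)
    qed (use neutral in auto)
    then show ?thesis
      using that[of V2 \<rho>2] V2 Node by blast
  next
    case False
    then show ?thesis
      using that[of V1 \<rho>] V1 by auto
  qed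
  obtain \<rho>3 where 3: "\<rho>2 \<subseteq>\<^sub>m \<rho>3" "state \<rho>3 V2" "(\<exists>\<delta><\<alpha>. borel_level \<delta> C) \<longrightarrow> depends_on V2 (overlay \<rho>3 -` C)"
  proof (cases "\<exists>\<delta><\<alpha>. borel_level \<delta> C")
    case True
    then obtain \<delta> where "\<delta> < \<alpha>" "borel_level \<delta> C"
      by blast
    from determine[OF 2(3) this] show ?thesis
      using that by blast
  next
    case False
    show ?thesis
      by (rule that[OF map_le_refl 2(3)]) (use False in blast)
  qed
  obtain \<rho>4 where 4: "\<rho>3 \<subseteq>\<^sub>m \<rho>4" "state \<rho>4 V2" "\<And>\<sigma>. \<sigma> \<subseteq> V2 \<Longrightarrow> resolved \<rho>4 V2 \<sigma> A"
    using 3(2) by (rule resolve) blast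
  have le: "\<rho>2 \<subseteq>\<^sub>m \<rho>4"
    using 3(1) 4(1) by (rule map_le_trans)
  have "depends_on V2 (overlay \<rho>4 -` C)" if "\<exists>\<delta><\<alpha>. borel_level \<delta> C"
  proof -
    have "depends_on (V2 - dom \<rho>4) (overlay \<rho>4 -` C)"
      unfolding vimage_overlay_le[OF 4(1), of C] using 3(3) that by (intro depends_on_overlay) blast
    then show ?thesis
      by (rule depends_on_mono) blast
  qed
  moreover have "\<rho> \<subseteq>\<^sub>m \<rho>4"
    using 2(2) le by (rule map_le_trans)
  moreover have "dead \<rho>4 s \<or> V2 \<inter> vars s \<noteq> {} \<and> (\<forall>c ts. s = Node c ts \<longrightarrow> vars (ts n) \<subseteq> dom \<rho>4 \<union> V2)"
    if s: "s \<in> B"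
  proof (cases "dead \<rho>2 s")
    case True
    then show ?thesis
      using dead_mono[OF _ le] by simp
  next
    case False
    then have *: "V2 \<inter> vars s \<noteq> {}" "\<And>c ts. s = Node c ts \<Longrightarrow> vars (ts n) \<subseteq> dom \<rho>2 \<union> V2"
      using 2(4) s by simp_all
    have "dom \<rho>2 \<union> V2 \<subseteq> dom \<rho>4 \<union> V2"
      using map_le_implies_dom_le[OF le] by (rule Un_mono) (rule subset_refl)
    then show ?thesis
      using * order_trans by metis
  qed
  moreover have "\<exists>s\<in>L. V \<inter> vars s = {} \<and> V2 \<inter> vars s \<noteq> {}" if "infinite L" "L \<subseteq> B"
    using V1(3) 2(1) that by blast
  moreover have "V \<subseteq> V2"
    using V1(1) 2(1) by (rule subset_trans)
  ultimately have "handled L s n C A (\<rho>, V) (\<rho>4, V2)"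
    unfolding handled_def prod.case using 4(3) by (intro conjI impI allI) simp_all
  then show ?thesis
    using 4(2) by blast
qed

text \<open>
  In the limit \<open>R\<close> of the restrictions, variables which were neither fixed nor starred become neutral. A block
  without a star was dead at some stage. In a starred block every child has been closed at some
  stage, after which the residual was disjoint from it; hence no child takes the controlling value unless the
  star does, and the block has collapsed to its star. A set of level \<open>\<alpha>\<close> was decided at some
  stage on each cylinder, and since all the sets \<open>C k\<close> were determined at later stages, the
  decisions are correct in the limit.
\<close>

lemma fusion:
  assumes \<L>: "countable \<L>" "\<And>L. L \<in> \<L> \<Longrightarrow> L \<subseteq> B" "\<And>L. L \<in> \<L> \<Longrightarrow> infinite L"
    and \<A>: "countable \<A>" "\<And>A. A \<in> \<A> \<Longrightarrow> borel_level \<alpha> A"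
  obtains \<rho> S where "\<And>L. L \<in> \<L> \<Longrightarrow> infinite (S \<inter> L)"
    "\<And>s. s \<in> B \<Longrightarrow> if s \<in> S then collapsed \<rho> s else dead \<rho> s"
    "\<And>i. i \<notin> \<Union>(vars ` B) \<Longrightarrow> \<rho> i = Some (\<zeta> i)"
    "\<And>A. A \<in> \<A> \<Longrightarrow> fin_supp (overlay \<rho> -` A)"
proof -
  have "\<exists>C. (\<forall>k::nat. \<exists>\<delta><\<alpha>. borel_level \<delta> (C k)) \<and> (A = (\<Inter>k. C k) \<or> - A = (\<Inter>k. C k))" if "A \<in> \<A>" for A
    using borel_level_normal_form[OF \<A>(2)[OF that] pos] by metis
  then have "\<forall>A\<in>\<A>. \<exists>C. (\<forall>k::nat. \<exists>\<delta><\<alpha>. borel_level \<delta> (C k)) \<and> (A = (\<Inter>k. C k) \<or> - A = (\<Inter>k. C k))"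
    by blast
  from bchoice[OF this] obtain C where
    C: "\<forall>A\<in>\<A>. (\<forall>k::nat. \<exists>\<delta><\<alpha>. borel_level \<delta> (C A k)) \<and> (A = (\<Inter>k. C A k) \<or> - A = (\<Inter>k. C A k))"
    by (rule exE)
  define p where "p n = fst (prod_decode n)" for n
  define q where "q n = snd (prod_decode n)" for n
  have pq: "\<exists>n. p n = a \<and> q n = b" for a b
    by (intro exI[of _ "prod_encode (a, b)"]) (simp add: p_def q_def)
  \<comment> \<open>Every value of \<open>p\<close> is attained infinitely often, as stars are needed infinitely often in each \<open>L\<close>.\<close>
  define L where "L n = from_nat_into \<L> (p n)" for n
  define s where "s n = from_nat_into B (p n)" for n
  define a where "a n = from_nat_into \<A> n" for n
  define \<rho>0 where "\<rho>0 i = (if i \<in> \<Union>(vars ` B) then None else Some (\<zeta> i))" for i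
  have B: "countable B"
  proof (rule countable_image_inj_on)
    show "countable ((\<lambda>s. SOME i. i \<in> vars s) ` B)"
      by simp
    show "inj_on (\<lambda>s. SOME i. i \<in> vars s) B"
      using block_eq vars_nonempty by (metis (mono_tags, lifting) ex_in_conv inj_onI someI_ex)
  qed
  have "state \<rho>0 {}"
  proof -
    have "live \<rho>0 {} s" if s: "s \<in> B" for s
    proof -
      obtain c ts where Node: "s = Node c ts"
        using full[OF s] by (rule block_Node)
      have none: "\<rho>0 i = None" if "i \<in> vars s" for i
        using s that by (auto simp: \<rho>0_def)
      have "residual \<rho>0 {} s s"
        unfolding residual_def
      proof (intro conjI allI)
        show "trims s s"
          unfolding Node by (rule trims_refl)
        show "vars s \<inter> (dom \<rho>0 \<union> {}) = {}"
          using none by (auto simp: dom_def)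
        fix x
        have "tree_val s (overlay \<rho>0 x) = tree_val s x"
          using none by (intro tree_val_cong) simp
        then show "tree_val s (overlay \<rho>0 x) = ctrl s \<longleftrightarrow>
            tree_val s x = ctrl s \<or> (\<exists>v \<in> {} \<inter> vars s. x v = ctrl s)"
          by simp
      qed (rule full[OF s])
      then show ?thesis
        unfolding live_def by blast
    qed
    then have "{s \<in> B. \<not> live \<rho>0 {} s} = {}"
      by blast
    then have "finite {s \<in> B. \<not> live \<rho>0 {} s}"
      by (simp only: finite.emptyI)
    then show ?thesis
      unfolding state_def using \<open>\<And>s. s \<in> B \<Longrightarrow> live \<rho>0 {} s\<close> by simp
  qed
  have "\<exists>S. \<forall>n. (state (fst (S n)) (snd (S n)) \<and> (n = 0 \<longrightarrow> S n = (\<rho>0, {}))) \<and>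
      handled (L n) (s n) (q n) (C (a (p n)) (q n)) (C (a n)) (S n) (S (Suc n))"
  proof (rule dependent_nat_choice)
    show "\<exists>S. state (fst S) (snd S) \<and> (0 = (0::nat) \<longrightarrow> S = (\<rho>0, {}))"
      using \<open>state \<rho>0 {}\<close> by (intro exI[of _ "(\<rho>0, {})"]) simp
    fix S and n :: nat
    assume "state (fst S) (snd S) \<and> (n = 0 \<longrightarrow> S = (\<rho>0, {}))"
    then have "state (fst S) (snd S)"
      by blast
    from handle[OF this, of "L n" "s n" "q n" "C (a (p n)) (q n)" "C (a n)"]
    obtain \<rho>' V' where "state \<rho>' V'" "handled (L n) (s n) (q n) (C (a (p n)) (q n)) (C (a n)) S (\<rho>', V')"
      by auto
    then show "\<exists>S'. (state (fst S') (snd S') \<and> (Suc n = 0 \<longrightarrow> S' = (\<rho>0, {}))) \<and>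
        handled (L n) (s n) (q n) (C (a (p n)) (q n)) (C (a n)) S S'"
      by (intro exI[of _ "(\<rho>', V')"]) simp
  qed
  then obtain S where S: "\<And>n. state (fst (S n)) (snd (S n))" "S 0 = (\<rho>0, {})"
    "\<And>n. handled (L n) (s n) (q n) (C (a (p n)) (q n)) (C (a n)) (S n) (S (Suc n))"
    by blast
  define \<rho> where "\<rho> n = fst (S n)" for n
  define V where "V n = snd (S n)" for n
  have st: "state (\<rho> n) (V n)" for n
    using S(1) by (simp add: \<rho>_def V_def)
  have step: "handled (L n) (s n) (q n) (C (a (p n)) (q n)) (C (a n)) (\<rho> n, V n) (\<rho> (Suc n), V (Suc n))" for n
    using S(3)[of n] by (simp add: \<rho>_def V_def)
  note step = step[unfolded handled_def prod.case]
  have step_\<rho>: "\<rho> n \<subseteq>\<^sub>m \<rho> (Suc n)" for n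
    using step[of n] by (elim conjE)
  have step_V: "V n \<subseteq> V (Suc n)" for n
    using step[of n] by (elim conjE)
  have step_star: "infinite (L n) \<and> L n \<subseteq> B \<longrightarrow> (\<exists>t\<in>L n. V n \<inter> vars t = {} \<and> V (Suc n) \<inter> vars t \<noteq> {})" for n
    using step[of n] by (elim conjE)
  have step_block: "s n \<in> B \<longrightarrow> dead (\<rho> (Suc n)) (s n) \<or> V (Suc n) \<inter> vars (s n) \<noteq> {} \<and>
      (\<forall>c ts. s n = Node c ts \<longrightarrow> vars (ts (q n)) \<subseteq> dom (\<rho> (Suc n)) \<union> V (Suc n))" for n
    using step[of n] by (elim conjE)
  have step_dep: "(\<exists>\<delta><\<alpha>. borel_level \<delta> (C (a (p n)) (q n))) \<longrightarrow> depends_on (V (Suc n)) (overlay (\<rho> (Suc n)) -` C (a (p n)) (q n))" for n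
    using step[of n] by (elim conjE)
  have step_resolved: "\<forall>\<sigma>\<subseteq>V (Suc n). resolved (\<rho> (Suc n)) (V (Suc n)) \<sigma> (C (a n))" for n
    using step[of n] by (elim conjE)
  have \<rho>_le: "\<rho> m \<subseteq>\<^sub>m \<rho> n" if "m \<le> n" for m n
    using step_\<rho> that by (rule map_le_stages)
  have V_le: "V m \<subseteq> V n" if "m \<le> n" for m n
    using step_V that by (rule lift_Suc_mono_le)
  define W where "W = (\<Union>n. V n)"
  define R where "R i = (if \<exists>n. i \<in> dom (\<rho> n) then \<rho> (SOME n. i \<in> dom (\<rho> n)) i
    else if i \<in> W then None else Some (neutral i))" for i
  have \<rho>_R: "\<rho> n \<subseteq>\<^sub>m R" for n
    unfolding map_le_def
  proof
    fix i assume i: "i \<in> dom (\<rho> n)"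
    define m where "m = (SOME n. i \<in> dom (\<rho> n))"
    have m: "i \<in> dom (\<rho> m)"
      unfolding m_def using i by (rule someI)
    have "\<rho> n i = \<rho> (max m n) i" "\<rho> m i = \<rho> (max m n) i"
      using \<rho>_le[of n "max m n"] \<rho>_le[of m "max m n"] i m by (auto simp: map_le_def)
    then show "\<rho> n i = R i"
      using i by (auto simp: R_def m_def[symmetric])
  qed
  have V_\<rho>: "\<rho> m i = None" if "i \<in> V n" for m n i
  proof -
    have "\<rho> (max m n) i = None"
      using state_None[OF st] V_le[of n "max m n"] that by auto
    then show ?thesis
      using \<rho>_le[of m "max m n"] by (metis domIff map_le_def max.cobounded1)
  qed
  have W_R: "R i = None" if "i \<in> W" for i
    using V_\<rho> that by (auto simp: R_def W_def domIff)
  have finished: "(\<exists>n. dead (\<rho> n) t) \<or>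
      W \<inter> vars t \<noteq> {} \<and> (\<forall>c ts. t = Node c ts \<longrightarrow> (\<exists>n. vars (ts k) \<subseteq> dom (\<rho> n) \<union> V n))"
    if t: "t \<in> B" for t k
  proof -
    obtain j where "from_nat_into B j = t"
      using from_nat_into_surj[OF B t] by blast
    then obtain n where n: "s n = t" "q n = k"
      using pq[of j k] unfolding s_def by blast
    have W: "V (Suc n) \<subseteq> W"
      unfolding W_def by blast
    have "dead (\<rho> (Suc n)) t \<or> V (Suc n) \<inter> vars t \<noteq> {} \<and>
      (\<forall>c ts. t = Node c ts \<longrightarrow> vars (ts k) \<subseteq> dom (\<rho> (Suc n)) \<union> V (Suc n))"
      using step_block[of n] t unfolding n by simp
    then show ?thesis
    proof (elim disjE conjE)
      assume "V (Suc n) \<inter> vars t \<noteq> {}"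
      then have "W \<inter> vars t \<noteq> {}"
        using W by blast
      moreover assume "\<forall>c ts. t = Node c ts \<longrightarrow> vars (ts k) \<subseteq> dom (\<rho> (Suc n)) \<union> V (Suc n)"
      ultimately show ?thesis
        by (intro disjI2 conjI allI impI exI[of _ "Suc n"]) simp_all
    qed (intro disjI1 exI)
  qed
  define T where "T = {t \<in> B. W \<inter> vars t \<noteq> {}}"
  show thesis
  proof (rule that[of T R])
    show "infinite (T \<inter> M)" if M: "M \<in> \<L>" for M
    proof -
      obtain j where j: "from_nat_into \<L> j = M"
        using from_nat_into_surj[OF \<L>(1) M] by blast
      define N where "N = {n. p n = j}"
      have "infinite N"
      proof -
        have "range (\<lambda>b. prod_encode (j, b)) \<subseteq> N"
          by (auto simp: N_def p_def)
        moreover have "infinite (range (\<lambda>b. prod_encode (j, b)))"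
          by (intro range_inj_infinite injI) simp
        ultimately show ?thesis
          using finite_subset by blast
      qed
      have "\<exists>t\<in>M. V n \<inter> vars t = {} \<and> V (Suc n) \<inter> vars t \<noteq> {}" if "n \<in> N" for n
      proof -
        have "L n = M"
          using that j by (simp add: N_def L_def)
        then show ?thesis
          using step_star[of n] \<L>(2,3)[OF M] by simp
      qed
      then have "\<forall>n\<in>N. \<exists>t. t \<in> M \<and> V n \<inter> vars t = {} \<and> V (Suc n) \<inter> vars t \<noteq> {}"
        by blast
      from bchoice[OF this] obtain f where
        f: "\<forall>n\<in>N. f n \<in> M \<and> V n \<inter> vars (f n) = {} \<and> V (Suc n) \<inter> vars (f n) \<noteq> {}"
        by (rule exE)
      \<comment> \<open>A block without a star at stage \<open>n\<close> cannot have got one at an earlier stage.\<close>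
      have neq: "f m \<noteq> f n" if "m \<in> N" "n \<in> N" "m < n" for m n
      proof
        assume eq: "f m = f n"
        have "V (Suc m) \<subseteq> V n"
          using that(3) by (intro V_le) simp
        moreover have "V (Suc m) \<inter> vars (f n) \<noteq> {}" "V n \<inter> vars (f n) = {}"
          using f that(1,2) eq by metis+
        ultimately show False
          by blast
      qed
      have "inj_on f N"
        using neq by (metis inj_onI linorder_neqE_nat)
      then have "infinite (f ` N)"
        using \<open>infinite N\<close> by (simp add: finite_image_iff)
      moreover have "f ` N \<subseteq> T \<inter> M"
      proof (rule image_subsetI)
        fix n assume "n \<in> N"
        then have "f n \<in> M" "V (Suc n) \<inter> vars (f n) \<noteq> {}"
          using f by simp_all
        moreover have "V (Suc n) \<subseteq> W"
          unfolding W_def by blast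
        ultimately show "f n \<in> T \<inter> M"
          using \<L>(2)[OF M] unfolding T_def by blast
      qed
      ultimately show ?thesis
        using finite_subset by blast
    qed
    show "if t \<in> T then collapsed R t else dead R t" if t: "t \<in> B" for t
    proof (cases "t \<in> T")
      case False
      then obtain n where "dead (\<rho> n) t"
        using finished[OF t] t unfolding T_def by blast
      then show ?thesis
        using False dead_mono[OF _ \<rho>_R] by simp
    next
      case True
      then obtain v where v: "v \<in> W" "v \<in> vars t"
        unfolding T_def by blast
      obtain c ts where Node: "t = Node c ts"
        using full[OF t] by (rule block_Node)
      have residual: "\<exists>n\<ge>m. \<exists>\<tau>. residual (\<rho> n) (V n) t \<tau> \<and> V n \<inter> vars t = {v}" for m
      proof -
        obtain n where "v \<in> V n"
          using v unfolding W_def by blast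
        then have v_V: "v \<in> V (max m n)"
          using V_le[of n "max m n"] by auto
        then have "live (\<rho> (max m n)) (V (max m n)) t"
          using state_cases[OF st t, of "max m n"] v by blast
        moreover have "V (max m n) \<inter> vars t = {v}"
          using v_V v(2) state_unique[OF st t] by blast
        ultimately show ?thesis
          unfolding live_def by (intro exI[of _ "max m n"]) simp
      qed
      have closed: "\<exists>n. vars (ts k) \<subseteq> dom (\<rho> n) \<union> V n" for k
      proof -
        have "\<not> dead (\<rho> n) t" for n
        proof
          assume dead: "dead (\<rho> n) t"
          obtain m \<tau> where m: "n \<le> m" "residual (\<rho> m) (V m) t \<tau>"
            using residual[of n] by blast
          then have "live (\<rho> m) (V m) t"
            unfolding live_def by blast
          then show False
            using live_not_dead dead_mono[OF dead \<rho>_le[OF m(1)]] by blast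
        qed
        then show ?thesis
          using finished[OF t, of k] Node by blast
      qed
      have "tree_val t (overlay R x) = x v" for x
      proof -
        define z where "z = overlay R x"
        have z_v: "z v = x v"
          using W_R[OF v(1)] by (simp add: z_def)
        have \<rho>_z: "overlay (\<rho> n) z = z" for n
          unfolding z_def by (rule overlay_le[OF \<rho>_R])
        have ctrl: "ctrl (Node c ts) = ctrl t"
          by (simp add: Node)
        show ?thesis
        proof (cases "x v = ctrl t")
          case True
          obtain n \<tau> where n: "residual (\<rho> n) (V n) t \<tau>" "V n \<inter> vars t = {v}"
            using residual[of 0] by blast
          have "tree_val t z = ctrl t"
            using residualD(4)[OF n(1), of z] True z_v unfolding \<rho>_z n(2) by simp
          then show ?thesis
            using True by (simp add: z_def)
        next
          case False
          have "tree_val (ts j) z \<noteq> ctrl t" for j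
          proof -
            obtain m where m: "vars (ts j) \<subseteq> dom (\<rho> m) \<union> V m"
              using closed by blast
            obtain n \<tau> where n: "m \<le> n" "residual (\<rho> n) (V n) t \<tau>" "V n \<inter> vars t = {v}"
              using residual[of m] by blast
            note \<tau> = residualD[OF n(2)]
            \<comment> \<open>Making the residual non-controlling does not affect the child \<open>j\<close>, which is already closed.\<close>
            define z' where "z' i = (if i \<in> vars \<tau> then \<not> ctrl t else z i)" for i
            have "v \<notin> vars \<tau>"
              using \<tau>(3) n(3) by blast
            then have "z' v \<noteq> ctrl t"
              using False z_v by (simp add: z'_def)
            moreover have "tree_val \<tau> z' = (\<not> ctrl t)"
              by (rule tree_val_const) (simp add: z'_def)
            ultimately have "tree_val t (overlay (\<rho> n) z') \<noteq> ctrl t"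
              unfolding \<tau>(4)[of z'] n(3) by simp
            then have "tree_val (ts j) (overlay (\<rho> n) z') \<noteq> ctrl t"
              using tree_val_eq_ctrl[of c ts "overlay (\<rho> n) z'"] unfolding ctrl Node[symmetric] by blast
            moreover have "tree_val (ts j) (overlay (\<rho> n) z') = tree_val (ts j) z"
            proof (rule tree_val_cong)
              fix i assume "i \<in> vars (ts j)"
              then have i: "i \<in> dom (\<rho> n) \<or> i \<in> V n"
                using m map_le_implies_dom_le[OF \<rho>_le[OF n(1)]] V_le[OF n(1)] by blast
              then have "z' i = z i"
                using \<tau>(3) by (auto simp: z'_def)
              then have "overlay (\<rho> n) z' i = overlay (\<rho> n) z i"
                by (simp add: overlay_def split: option.split)
              then show "overlay (\<rho> n) z' i = z i"
                unfolding \<rho>_z .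
            qed
            ultimately show ?thesis
              by simp
          qed
          then have "tree_val t z \<noteq> ctrl t"
            using tree_val_eq_ctrl[of c ts z] unfolding ctrl Node[symmetric] by blast
          then show ?thesis
            using False by (simp add: z_def)
        qed
      qed
      moreover have "v \<notin> dom R"
        using W_R[OF v(1)] by (simp add: domIff)
      ultimately show ?thesis
        using True v(2) unfolding collapsed_def by auto
    qed
    show "R i = Some (\<zeta> i)" if "i \<notin> \<Union>(vars ` B)" for i
    proof -
      have "\<rho> 0 i = Some (\<zeta> i)"
        using that S(2) by (simp add: \<rho>_def \<rho>0_def)
      then show ?thesis
        using \<rho>_R[of 0] unfolding map_le_def by (metis domI)
    qed
    show "fin_supp (overlay R -` A)" if A: "A \<in> \<A>" for A
    proof -
      obtain m where m: "a m = A"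
        unfolding a_def using from_nat_into_surj[OF \<A>(1) A] by blast
      let ?\<rho> = "\<rho> (Suc m)" and ?V = "V (Suc m)"
      have R_x: "overlay R x i = x i" if "i \<in> V n" for x i n
        using that W_R[of i] by (intro overlay_None) (auto simp: W_def)
      have iff: "x \<in> overlay R -` (\<Inter>k. C A k) \<longleftrightarrow> \<not> excluded ?\<rho> ?V {i \<in> ?V. x i} (C A)" for x
      proof (cases "excluded ?\<rho> ?V {i \<in> ?V. x i} (C A)")
        case True
        then obtain k where k: "\<forall>y. {i \<in> ?V. y i} = {i \<in> ?V. x i} \<longrightarrow> overlay ?\<rho> y \<notin> C A k"
          unfolding excluded_def by (rule exE)
        have "{i \<in> ?V. overlay R x i} = {i \<in> ?V. x i}"
          by (intro Collect_cong conj_cong) (simp_all add: R_x)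
        then have "overlay R x \<notin> C A k"
          using k[rule_format, of "overlay R x"] unfolding overlay_le[OF \<rho>_R] by simp
        then show ?thesis
          using True by auto
      next
        case False
        have "{i \<in> ?V. x i} \<subseteq> ?V"
          by blast
        then have "resolved ?\<rho> ?V {i \<in> ?V. x i} (C A)"
          using step_resolved[of m] unfolding m by (elim allE impE)
        then have inc: "included ?\<rho> ?V {i \<in> ?V. x i} (C A)"
          using False unfolding resolved_def by argo
        have "overlay R x \<in> C A k" for k
        proof -
          obtain n where n: "p n = m" "q n = k"
            using pq by blast
          have "\<exists>\<delta><\<alpha>. borel_level \<delta> (C A k)"
            using C A by blast
          then have dep_n: "depends_on (V (Suc n)) (overlay (\<rho> (Suc n)) -` C A k)"
            using step_dep[of n] unfolding n m by simp
          define N where "N = max (Suc m) (Suc n)"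
          have N: "Suc m \<le> N" "Suc n \<le> N"
            by (simp_all add: N_def)
          have "depends_on (V (Suc n) - dom (\<rho> N)) (overlay (\<rho> N) -` C A k)"
            using depends_on_overlay[OF dep_n, of "\<rho> N"] unfolding vimage_overlay_le[OF \<rho>_le[OF N(2)], of "C A k"] .
          then have dep_N: "depends_on (V N) (overlay (\<rho> N) -` C A k)"
            by (rule depends_on_mono) (use V_le[OF N(2)] in \<open>simp add: Diff_subset_conv le_supI2\<close>)
          \<comment> \<open>Only \<open>V N\<close> matters at stage \<open>N\<close>, so the input may be changed elsewhere to make it relevant.\<close>
          define y where "y i = (if i \<in> V N then x i else neutral i)" for i
          have "neutral_off ?V y"
            unfolding neutral_off_def
          proof (intro ballI impI)
            fix t i assume t: "t \<in> B" "?V \<inter> vars t \<noteq> {}" and i: "i \<in> vars t - ?V"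
            have "i \<notin> V N"
              using t i state_unique[OF st t(1)] V_le[OF N(1)] by blast
            then show "y i = (\<not> ctrl t)"
              using neutral[OF t(1)] i by (simp add: y_def)
          qed
          moreover have "{i \<in> ?V. y i} = {i \<in> ?V. x i}"
            using V_le[OF N(1)] by (auto simp: y_def)
          ultimately have "overlay (\<rho> N) y \<in> C A k"
            using inc \<rho>_le[OF N(1)] V_le[OF N(1)] st dep_N by (intro includedD)
          moreover have "overlay R x \<in> overlay (\<rho> N) -` C A k \<longleftrightarrow> y \<in> overlay (\<rho> N) -` C A k"
            by (rule depends_onD[OF dep_N]) (simp add: R_x y_def)
          ultimately show ?thesis
            by (simp add: overlay_le[OF \<rho>_R])
        qed
        then show ?thesis
          using False by simp
      qed
      have "depends_on ?V (overlay R -` (\<Inter>k. C A k))"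
        unfolding depends_on_def
      proof (intro allI impI)
        fix x y :: "nat \<Rightarrow> bool"
        assume "\<forall>i\<in>?V. x i = y i"
        then have "{i \<in> ?V. x i} = {i \<in> ?V. y i}"
          by blast
        then show "x \<in> overlay R -` (\<Inter>k. C A k) \<longleftrightarrow> y \<in> overlay R -` (\<Inter>k. C A k)"
          unfolding iff by simp
      qed
      then have "fin_supp (overlay R -` (\<Inter>k. C A k))"
        unfolding fin_supp_def using state_finite[OF st] by blast
      moreover have "A = (\<Inter>k. C A k) \<or> - A = (\<Inter>k. C A k)"
        using C A by blast
      ultimately show ?thesis
        by (metis fin_supp_Compl vimage_Compl)
    qed
  qed
qed

end

section \<open>Switching at every rank\<close>

text \<open>
  The blocks of all trees in the family are fused together, since the sets must be made clopen by
  a single restriction.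
\<close>

lemma switching_indecomposable:
  assumes pos: "0 < \<alpha>" and indec: "\<And>\<delta>. \<delta> < \<alpha> \<Longrightarrow> \<delta> + \<alpha> = \<alpha>"
    and below: "\<And>\<delta>. \<delta> < \<alpha> \<Longrightarrow> switching \<delta>"
  shows "switching \<alpha>"
  unfolding switching_def
proof (intro allI impI)
  fix \<A> :: "(nat \<Rightarrow> bool) set set" and I :: "tree set" and t rk
  assume \<A>: "countable \<A>" "\<forall>A\<in>\<A>. borel_level \<alpha> A"
    and I: "\<forall>s\<in>I. 0 < rk s \<and> full_alternating_tree (\<alpha> + rk s) (t s)"
    and disj: "disjoint_family_on (\<lambda>s. vars (t s)) I"
  have I_eq: "s = s'" if "s \<in> I" "s' \<in> I" "i \<in> vars (t s)" "i \<in> vars (t s')" for s s' i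
    using disj that unfolding disjoint_family_on_def by blast
  have "\<exists>B \<L> \<zeta>. contraction \<alpha> (rk s) (t s) B \<L> \<zeta>" if "s \<in> I" for s
    using ex_contraction[OF pos] I that by blast
  then obtain B \<L> \<zeta> where con: "\<And>s. s \<in> I \<Longrightarrow> contraction \<alpha> (rk s) (t s) (B s) (\<L> s) (\<zeta> s)"
    by metis
  note con = con[unfolded contraction_def]
  have B: "full_alternating_tree \<alpha> b" "vars b \<subseteq> vars (t s)" if "s \<in> I" "b \<in> B s" for s b
    using con[OF that(1)] that(2) by simp_all
  define B' where "B' = (\<Union>s\<in>I. B s)"
  define \<L>' where "\<L>' = (\<Union>s\<in>I. \<L> s)"
  define \<zeta>' where "\<zeta>' i = \<zeta> (THE s. s \<in> I \<and> i \<in> vars (t s)) i" for i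
  have \<zeta>': "\<zeta>' i = \<zeta> s i" if "s \<in> I" "i \<in> vars (t s)" for s i
  proof -
    have "(THE s. s \<in> I \<and> i \<in> vars (t s)) = s"
      using that I_eq by blast
    then show ?thesis
      by (simp add: \<zeta>'_def)
  qed
  interpret blocks \<alpha> B'
  proof
    show "full_alternating_tree \<alpha> b" if "b \<in> B'" for b
      using that B(1) unfolding B'_def by blast
    show "disjoint_family_on vars B'"
      unfolding disjoint_family_on_def
    proof (intro ballI impI)
      fix b b' assume b: "b \<in> B'" "b' \<in> B'" "b \<noteq> b'"
      obtain s s' where s: "s \<in> I" "b \<in> B s" "s' \<in> I" "b' \<in> B s'"
        using b unfolding B'_def by blast
      show "vars b \<inter> vars b' = {}"
      proof (cases "s = s'")
        case True
        have "disjoint_family_on vars (B s)"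
          using con[OF s(1)] by blast
        then show ?thesis
          using s b(3) True unfolding disjoint_family_on_def by blast
      next
        case False
        then show ?thesis
          using B(2)[OF s(1,2)] B(2)[OF s(3,4)] I_eq[OF s(1,3)] by blast
      qed
    qed
  qed (use pos indec below in auto)
  have "countable I"
  proof (rule countable_image_inj_on)
    show "countable ((\<lambda>s. SOME i. i \<in> vars (t s)) ` I)"
      by simp
    show "inj_on (\<lambda>s. SOME i. i \<in> vars (t s)) I"
      using I_eq vars_nonempty by (metis (mono_tags, lifting) ex_in_conv inj_onI someI_ex)
  qed
  then have "countable \<L>'"
    using con unfolding \<L>'_def by blast
  have \<L>_B: "L \<subseteq> B' \<and> infinite L" if "L \<in> \<L>'" for L
  proof -
    obtain s where s: "s \<in> I" "L \<in> \<L> s"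
      using \<open>L \<in> \<L>'\<close> unfolding \<L>'_def by blast
    then have "L \<subseteq> B s" "infinite L"
      using con[OF s(1)] by simp_all
    then show ?thesis
      using s(1) unfolding B'_def by blast
  qed
  obtain \<rho> S where \<rho>: "\<And>L. L \<in> \<L>' \<Longrightarrow> infinite (S \<inter> L)"
    "\<And>s. s \<in> B' \<Longrightarrow> if s \<in> S then collapsed \<rho> s else dead \<rho> s"
    "\<And>i. i \<notin> \<Union>(vars ` B') \<Longrightarrow> \<rho> i = Some (\<zeta>' i)"
    "\<And>A. A \<in> \<A> \<Longrightarrow> fin_supp (overlay \<rho> -` A)"
    by (rule fusion[of \<L>' \<A> \<zeta>']) (use \<open>countable \<L>'\<close> \<L>_B \<A> in auto)
  have "reduces \<rho> (rk s) (t s)" if s: "s \<in> I" for s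
  proof -
    have 1: "\<forall>L\<in>\<L> s. infinite (S \<inter> L)"
      using \<rho>(1) s unfolding \<L>'_def by blast
    have 2: "\<forall>b\<in>B s. if b \<in> S then collapsed \<rho> b else dead \<rho> b"
      using \<rho>(2) s unfolding B'_def by blast
    have 3: "\<forall>i \<in> vars (t s) - \<Union>(vars ` B s). \<rho> i = Some (\<zeta> s i)"
    proof
      fix i assume i: "i \<in> vars (t s) - \<Union>(vars ` B s)"
      have "i \<notin> \<Union>(vars ` B')"
      proof
        assume "i \<in> \<Union>(vars ` B')"
        then obtain s' b where s': "s' \<in> I" "b \<in> B s'" "i \<in> vars b"
          unfolding B'_def by blast
        then have "s' = s"
          using B(2)[OF s'(1,2)] I_eq[OF s'(1) s] i by blast
        then show False
          using s' i by blast
      qed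
      then show "\<rho> i = Some (\<zeta> s i)"
        using \<rho>(3) \<zeta>'[OF s] i by simp
    qed
    show ?thesis
      using con[OF s, THEN conjunct2, THEN conjunct2, THEN conjunct2, THEN conjunct2, rule_format, of S \<rho>] 1 2 3
      by blast
  qed
  then show "\<exists>\<rho>. (\<forall>A\<in>\<A>. fin_supp (overlay \<rho> -` A)) \<and> (\<forall>s\<in>I. reduces \<rho> (rk s) (t s))"
    using \<rho>(4) by blast
qed

text \<open>
  If \<open>\<delta> + \<alpha> \<noteq> \<alpha>\<close> for some \<open>\<delta> < \<alpha>\<close>, then \<open>\<alpha> = \<delta> + \<eta>\<close> for some \<open>\<eta> < \<alpha>\<close>.
\<close>

lemma switching_every_rank: "switching \<alpha>"
proof (induction \<alpha> rule: less_induct)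
  case (less \<alpha>)
  consider "\<alpha> = 0" | \<delta> where "\<delta> < \<alpha>" "\<delta> + \<alpha> \<noteq> \<alpha>" | "0 < \<alpha>" "\<And>\<delta>. \<delta> < \<alpha> \<Longrightarrow> \<delta> + \<alpha> = \<alpha>"
    using zero_le_omega1[of \<alpha>] by (metis le_less)
  then show ?case
  proof cases
    case 1
    then show ?thesis
      by (simp add: switching_zero)
  next
    case 2
    obtain \<eta> where \<eta>: "\<alpha> = \<delta> + \<eta>"
      using less_imp_le[OF 2(1)] by (rule oadd_subtract)
    have "\<eta> \<noteq> \<alpha>"
      using 2(2) \<eta> by auto
    moreover have "\<eta> \<le> \<alpha>"
      unfolding \<eta> by (rule le_oadd_right)
    ultimately have "switching \<eta>"
      using less by simp
    then show ?thesis
      unfolding \<eta> using less[OF 2(1)] by (intro switching_oadd)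
  next
    case 3
    then show ?thesis
      using less by (rule switching_indecomposable)
  qed
qed

section \<open>Clopen sets and continuity\<close>

definition cylinder :: "(nat \<Rightarrow> bool) \<Rightarrow> nat set \<Rightarrow> (nat \<Rightarrow> bool) set"
  where "cylinder x D = {y. \<forall>i\<in>D. y i = x i}"

lemma openin_cylinder:
  assumes "finite D"
  shows "openin (cantor UNIV) (cylinder x D)"
proof -
  have "openin (cantor UNIV) (Pi\<^sub>E UNIV (\<lambda>i. if i \<in> D then {x i} else UNIV))"
    unfolding cantor_def
  proof (rule product_topology_basis)
    show "finite {i. (if i \<in> D then {x i} else UNIV) \<noteq> topspace (discrete_topology UNIV)}"
      by (rule finite_subset[OF _ assms]) auto
  qed simp
  moreover have "Pi\<^sub>E UNIV (\<lambda>i. if i \<in> D then {x i} else UNIV) = cylinder x D"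
    by (auto simp: cylinder_def PiE_def Pi_def extensional_def split: if_splits)
  ultimately show ?thesis
    by simp
qed

lemma openin_fin_supp:
  assumes "fin_supp A"
  shows "openin (cantor UNIV) A"
proof -
  obtain D where D: "finite D" "depends_on D A"
    using assms by (auto simp: fin_supp_def)
  have "y \<in> A" if "x \<in> A" "y \<in> cylinder x D" for x y
    using depends_onD[OF D(2), of y x] that by (simp add: cylinder_def)
  moreover have "x \<in> cylinder x D" for x
    by (simp add: cylinder_def)
  ultimately have "A = (\<Union>x\<in>A. cylinder x D)"
    by blast
  moreover have "openin (cantor UNIV) (\<Union>x\<in>A. cylinder x D)"
    using openin_cylinder[OF D(1)] by blast
  ultimately show ?thesis
    by simp
qed

lemma openin_cantor_cylinder:
  assumes "openin (cantor UNIV) S" "x \<in> S"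
  obtains D where "finite D" "cylinder x D \<subseteq> S"
proof -
  obtain U where U: "finite {i. U i \<noteq> (UNIV :: bool set)}" "x \<in> Pi\<^sub>E UNIV U" "Pi\<^sub>E UNIV U \<subseteq> S"
    using assms unfolding cantor_def openin_product_topology_alt by auto
  have "cylinder x {i. U i \<noteq> UNIV} \<subseteq> Pi\<^sub>E UNIV U"
  proof
    fix y assume y: "y \<in> cylinder x {i. U i \<noteq> UNIV}"
    have "y i \<in> U i" for i
    proof (cases "U i = UNIV")
      case False
      then have "y i = x i"
        using y by (simp add: cylinder_def)
      then show ?thesis
        using U(2) by auto
    qed simp
    then show "y \<in> Pi\<^sub>E UNIV U"
      by (simp add: PiE_iff)
  qed
  then show thesis
    using that U by blast
qed

text \<open>
  The space is covered by cylinders on which membership in \<open>S\<close> is constant; finitely many of them suffice.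
\<close>

lemma fin_supp_clopen:
  assumes "openin (cantor UNIV) S" "closedin (cantor UNIV) S"
  shows "fin_supp S"
proof -
  have "openin (cantor UNIV) (- S)"
    using assms(2) by (simp add: closedin_def topspace_cantor_UNIV Compl_eq_Diff_UNIV)
  then have "\<forall>x. \<exists>D. finite D \<and> (\<forall>y\<in>cylinder x D. y \<in> S \<longleftrightarrow> x \<in> S)"
    using assms(1) openin_cantor_cylinder by (metis ComplD ComplI subsetD)
  then obtain D where D: "\<And>x. finite (D x)" "\<And>x y. y \<in> cylinder x (D x) \<Longrightarrow> y \<in> S \<longleftrightarrow> x \<in> S"
    by metis
  have "compact_space (cantor UNIV)"
    unfolding cantor_def by (simp add: compact_space_product_topology compact_space_discrete_topology)
  moreover have "openin (cantor UNIV) U" if "U \<in> range (\<lambda>x. cylinder x (D x))" for U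
    using that openin_cylinder D(1) by blast
  moreover have "topspace (cantor UNIV) \<subseteq> \<Union>(range (\<lambda>x. cylinder x (D x)))"
  proof
    fix x :: "nat \<Rightarrow> bool"
    have "x \<in> cylinder x (D x)"
      by (simp add: cylinder_def)
    then show "x \<in> \<Union>(range (\<lambda>x. cylinder x (D x)))"
      by blast
  qed
  ultimately have "\<exists>\<F>. finite \<F> \<and> \<F> \<subseteq> range (\<lambda>x. cylinder x (D x)) \<and> topspace (cantor UNIV) \<subseteq> \<Union>\<F>"
    unfolding compact_space_alt by (elim allE impE) (intro conjI ballI)
  then obtain \<F> where \<F>: "finite \<F>" "\<F> \<subseteq> range (\<lambda>x. cylinder x (D x))" "UNIV \<subseteq> \<Union>\<F>"
    unfolding topspace_cantor_UNIV by blast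
  obtain F where F: "finite F" "\<F> = (\<lambda>x. cylinder x (D x)) ` F"
    using finite_subset_image[OF \<F>(1,2)] by blast
  have "depends_on (\<Union>x\<in>F. D x) S"
    unfolding depends_on_def
  proof (intro allI impI)
    fix y z :: "nat \<Rightarrow> bool"
    assume yz: "\<forall>i \<in> (\<Union>x\<in>F. D x). y i = z i"
    obtain x where x: "x \<in> F" "y \<in> cylinder x (D x)"
      using \<F>(3) F(2) by blast
    then have "z \<in> cylinder x (D x)"
      using yz by (auto simp: cylinder_def)
    then show "y \<in> S \<longleftrightarrow> z \<in> S"
      using D(2) x(2) by blast
  qed
  then show ?thesis
    unfolding fin_supp_def using F(1) D(1) by blast
qed

lemma borel_level_Sigma0: "Sigma0 (cantor UNIV) \<gamma> S \<Longrightarrow> borel_level \<gamma> S"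
  and borel_level_Pi0: "Pi0 (cantor UNIV) \<gamma> S \<Longrightarrow> borel_level \<gamma> S"
proof (induction rule: Sigma0_Pi0.inducts)
  case (Sigma0_Union \<alpha> \<beta> S)
  then have "borel_level \<alpha> (- (\<Inter>n. - S n))"
    by (intro borel_level_Compl borel_level_INT[of \<beta>]) auto
  then show ?case
    by simp
next
  case (Pi0_Inter \<alpha> \<beta> S)
  then show ?case
    by (intro borel_level_INT[of \<beta>]) auto
qed (simp_all add: fin_supp_clopen borel_level_fin_supp)

lemma Sigma0_osuc:
  assumes "Sigma0 (cantor UNIV) (osuc \<alpha>) S"
  obtains A where "\<And>n::nat. borel_level \<alpha> (A n)" "S = (\<Union>n. A n)"
  using assms
proof cases
  case Sigma0_clopen
  then show ?thesis
    using that[of "\<lambda>_. S"] fin_supp_clopen borel_level_fin_supp by auto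
next
  case (Sigma0_Union \<beta> A)
  have "borel_level \<alpha> (A n)" for n
    using borel_level_Pi0[OF Sigma0_Union(4)] borel_level_mono osuc_le_iff[of \<alpha> "\<beta> n"] Sigma0_Union(3)[of n]
    by (metis not_less)
  then show ?thesis
    using that[of A] Sigma0_Union(1) by simp
qed

text \<open>
  The space \<open>2\<^sup>I\<close> embeds into \<open>2\<^sup>\<nat>\<close> by the identity, the points of \<open>2\<^sup>I\<close> being extensional functions
  with a constant default value off \<open>I\<close>.
\<close>

lemma continuous_restr:
  assumes "\<And>k b. openin (cantor UNIV) {x. f (overlay \<rho> x) k = b}"
  shows "continuous_map (cantor I) (cantor UNIV) (restr \<rho> f)"
proof -
  have "overlay \<rho> x = (\<lambda>i. case \<rho> i of None \<Rightarrow> x i | Some b \<Rightarrow> b)" for x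
    by (rule ext) (rule overlay_def)
  then have restr: "restr \<rho> f = (\<lambda>x. f (overlay \<rho> x)) \<circ> (\<lambda>x. x)"
    by (intro ext) (simp only: restr_def o_apply)
  have "continuous_map (cantor I) (cantor UNIV) (\<lambda>x. x)"
    unfolding cantor_def continuous_map_componentwise_UNIV
  proof
    fix i
    show "continuous_map (product_topology (\<lambda>i. discrete_topology UNIV) I) (discrete_topology UNIV) (\<lambda>x. x i :: bool)"
    proof (cases "i \<in> I")
      case True
      then show ?thesis
        by (rule continuous_map_product_projection)
    next
      case False
      show ?thesis
      proof (rule continuous_map_eq)
        show "continuous_map (product_topology (\<lambda>i. discrete_topology UNIV) I) (discrete_topology UNIV)
          (\<lambda>_. undefined :: bool)"
          by simp
      qed (use False in \<open>auto simp: PiE_def extensional_def\<close>)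
    qed
  qed
  moreover have "continuous_map (cantor UNIV) (cantor UNIV) (\<lambda>x. f (overlay \<rho> x))"
  proof -
    have "continuous_map (cantor UNIV) (discrete_topology UNIV) (\<lambda>x. f (overlay \<rho> x) k)" for k
      unfolding continuous_map_def
    proof (intro conjI allI impI)
      fix U :: "bool set"
      have "{x \<in> topspace (cantor UNIV). f (overlay \<rho> x) k \<in> U} = (\<Union>b\<in>U. {x. f (overlay \<rho> x) k = b})"
        by (auto simp: topspace_cantor_UNIV)
      then show "openin (cantor UNIV) {x \<in> topspace (cantor UNIV). f (overlay \<rho> x) k \<in> U}"
        using assms by auto
    qed simp
    then show ?thesis
      by (subst (2) cantor_def) (simp add: continuous_map_componentwise_UNIV)
  qed
  ultimately show ?thesis
    unfolding restr by (rule continuous_map_compose)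
qed

section \<open>Restrictions that make a function continuous\<close>

theorem theorem1p1:
  fixes \<alpha> \<beta> :: omega1
    and f :: "(nat \<Rightarrow> bool) \<Rightarrow> (nat \<Rightarrow> bool)"
    and g :: "(nat \<Rightarrow> bool) \<Rightarrow> bool"
  assumes "Sigma0_measurable (osuc \<alpha>) (cantor UNIV) (cantor UNIV) f"
    and "tree_function UNIV (\<alpha> + \<beta>) g"
  shows "\<exists>\<rho> :: restriction.
    continuous_map (cantor (stars \<rho>)) (cantor UNIV) (restr \<rho> f) \<and>
    tree_function (stars \<rho>) \<beta> (restr \<rho> g)"
proof -
  have "Sigma0 (cantor UNIV) (osuc \<alpha>) {x. f x k = b}" for k b
  proof -
    have "openin (cantor UNIV) {y. y k = b}"
      by (rule openin_fin_supp) (auto simp: fin_supp_def depends_on_def intro: exI[of _ "{k}"])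
    then show ?thesis
      using assms(1) unfolding Sigma0_measurable_def topspace_cantor_UNIV by auto
  qed
  then have "\<forall>k b. \<exists>A. (\<forall>n::nat. borel_level \<alpha> (A n)) \<and> {x. f x k = b} = (\<Union>n. A n)"
    using Sigma0_osuc by metis
  then obtain A where A: "\<And>k b n. borel_level \<alpha> (A k b (n::nat))" "\<And>k b. {x. f x k = b} = (\<Union>n. A k b n)"
    by metis
  define \<A> where "\<A> = (\<Union>k. \<Union>b. range (A k b))"
  have \<A>: "countable \<A>"
    by (simp add: \<A>_def)
  obtain t where t: "full_alternating_tree (\<alpha> + \<beta>) t" "\<And>x. g x = tree_val t x"
    using assms(2) by (auto simp: tree_function_def topspace_cantor_UNIV)
  have "\<exists>\<rho> t'. (\<forall>C\<in>\<A>. fin_supp (overlay \<rho> -` C)) \<and> full_alternating_tree \<beta> t' \<and>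
    vars t' \<inter> dom \<rho> = {} \<and> (\<forall>x. tree_val t (overlay \<rho> x) = tree_val t' x)"
  proof (cases "\<beta> = 0")
    case True
    \<comment> \<open>With a single unrestricted variable every set has finite support.\<close>
    obtain v where "v \<in> vars t"
      using vars_nonempty by blast
    then obtain \<rho> where \<rho>: "dom \<rho> = - {v}" "\<forall>x. tree_val t (overlay \<rho> x) = x v"
      using collapse_to_leaf t(1) unfolding full_alternating_tree_def by blast
    have "depends_on {v} (overlay \<rho> -` C)" for C
    proof -
      have "depends_on (UNIV - dom \<rho>) (overlay \<rho> -` C)"
        by (rule depends_on_overlay) (simp add: depends_on_def fun_eq_iff[symmetric])
      then show ?thesis
        by (simp add: \<rho>(1))
    qed
    then show ?thesis
      using \<rho> True by (intro exI[of _ \<rho>] exI[of _ "Leaf v"])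
        (auto simp: fin_supp_def full_alternating_tree_def intro: full_tree.intros)
  next
    case False
    then have "0 < \<beta>"
      using zero_le_omega1[of \<beta>] by simp
    obtain \<rho> where "\<And>C. C \<in> \<A> \<Longrightarrow> fin_supp (overlay \<rho> -` C)" "\<And>s. s \<in> {t} \<Longrightarrow> reduces \<rho> \<beta> s"
      by (rule switchingD[OF switching_every_rank[of \<alpha>] \<A>, of "{t}" "\<lambda>_. \<beta>" "\<lambda>s. s"])
        (use A(1) t(1) \<open>0 < \<beta>\<close> in \<open>auto simp: \<A>_def disjoint_family_on_def\<close>)
    then show ?thesis
      unfolding reduces_def by blast
  qed
  then obtain \<rho> t' where \<rho>: "\<forall>C\<in>\<A>. fin_supp (overlay \<rho> -` C)"
    and t': "full_alternating_tree \<beta> t'" "vars t' \<inter> dom \<rho> = {}" "\<forall>x. tree_val t (overlay \<rho> x) = tree_val t' x"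
    by blast
  have "continuous_map (cantor (stars \<rho>)) (cantor UNIV) (restr \<rho> f)"
  proof (rule continuous_restr)
    fix k b
    have "{x. f (overlay \<rho> x) k = b} = (\<Union>n. overlay \<rho> -` A k b n)"
      using A(2)[of k b] by blast
    moreover have "openin (cantor UNIV) (overlay \<rho> -` A k b n)" for n
      using \<rho> by (intro openin_fin_supp) (auto simp: \<A>_def)
    ultimately show "openin (cantor UNIV) {x. f (overlay \<rho> x) k = b}"
      by auto
  qed
  moreover have "tree_function (stars \<rho>) \<beta> (restr \<rho> g)"
    unfolding tree_function_def
  proof (intro exI[of _ t'] conjI ballI)
    show "vars t' \<subseteq> stars \<rho>"
      using t'(2) by (auto simp: stars_def domIff)
    show "restr \<rho> g x = tree_val t' x" for x
      using t(2) t'(3) by (simp add: restr_def overlay_def[abs_def])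
  qed (rule t'(1))
  ultimately show ?thesis
    by blast
qed

end
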